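(* Let $X$ be a connected complex manifold and let $n\geq 1$ be an integer. Then the $n$-th symmetric power $X^n_{sym}$ is quasi $c$-finitely compact if and only if $X$ is quasi $c$-finitely compact.
   Context: $\mathbb D$ is the open unit disc in $\mathbb C$ and $p$ is the Poincaré distance on $\mathbb D$ (so $p(0,\sigma)=\operatorname{artanh}|\sigma|$). Symmetric power: for a connected complex manifold $X$, $X^n_{sym}$ is the quotient of $X^n$ (with the quotient topology) under the action of the group of all permutations of $\{1,\ldots,n\}$ permuting the coordinates; it carries the structure of a complex analytic space. The class of $(z_1,\ldots,z_n)\in X^n$ is denoted $\langle z_1,\ldots,z_n\rangle$. Holomorphic functions $X^n_{sym}\to\mathbb D$ are identified with symmetric holomorphic functions $X^n\to\mathbb D$, i.e. holomorphic $F$ with $F(z_{\sigma(1)},\ldots,z_{\sigma(n)})=F(z_1,\ldots,z_n)$ for every permutation $\sigma$; the set of these is $\mathcal O_s(X^n,\mathbb D)$. Carathéodory pseudodistance: for a complex manifold $X$, $c_X(z,w)=\sup\{p(0,f(w)): f\in\mathcal O(X,\mathbb D),\ f(z)=0\}$. For the symmetric power, $$c_{X^n_{sym}}(\langle z_1,\ldots,z_n\rangle,\langle w_1,\ldots,w_n\rangle)=\sup\{p(0,F(w_1,\ldots,w_n)):F\in\mathcal O_s(X^n,\mathbb D),\ F(z_1,\ldots,z_n)=0\}.$$ Quasi $c$-finite compactness: a space $Z$ (here $Z=X$ or $Z=X^n_{sym}$) is quasi $c$-finitely compact if for any sequence $(z_k)_{k\ge1}\subset Z$ without accumulation point in $Z$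 we have $c_Z(z_1,z_k)\to\infty$ as $k\to\infty$. *)

theory Defs
  imports "HOL-Analysis.Analysis" "HOL-Combinatorics.Permutations"
begin

section \<open>Complex manifolds\<close>

text \<open>
  Points of the \<open>d\<close>-dimensional complex space are functions on \<open>{..<d}\<close>, extended by
  \<open>undefined\<close>; the dimension is a natural number, so that the dimension \<open>n * d\<close> of
  a power of a manifold can be expressed, and \<open>d = 0\<close> is allowed.
\<close>

definition cspace :: "nat \<Rightarrow> (nat \<Rightarrow> complex) topology" where
  "cspace d = product_topology (\<lambda>_. euclidean) {..<d}"

text \<open>
  Complex Frechet differentiability at every point; the size of the increment is measured by the
  \<open>\<ell>\<^sup>1\<close>-norm. Meant for open \<open>V\<close> only.
\<close>

definition cholomorphic_on :: "nat \<Rightarrow> ((nat \<Rightarrow> complex) \<Rightarrow> complex) \<Rightarrow> (nat \<Rightarrow> complex) set \<Rightarrow> bool" where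
  "cholomorphic_on d f V \<longleftrightarrow>
     (\<forall>a\<in>V. \<exists>c :: nat \<Rightarrow> complex.
        ((\<lambda>z. norm (f z - f a - (\<Sum>i<d. c i * (z i - a i))) / (\<Sum>i<d. norm (z i - a i))) \<longlongrightarrow> 0)
          (atin (cspace d) a))"

text \<open>A chart is a pair of an open set and a coordinate map on it.\<close>

type_synonym 'a chart = "'a set \<times> ('a \<Rightarrow> nat \<Rightarrow> complex)"

definition is_chart :: "nat \<Rightarrow> 'a topology \<Rightarrow> 'a chart \<Rightarrow> bool" where
  "is_chart d X = (\<lambda>(U, \<phi>).
     openin X U \<and> openin (cspace d) (\<phi> ` U) \<and>
     homeomorphic_map (subtopology X U) (subtopology (cspace d) (\<phi> ` U)) \<phi>)"

definition holomorphic_transition :: "nat \<Rightarrow> 'a chart \<Rightarrow> 'a chart \<Rightarrow> bool" where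
  "holomorphic_transition d = (\<lambda>(U, \<phi>) (V, \<psi>).
     \<forall>i<d. cholomorphic_on d (\<lambda>x. \<psi> (inv_into U \<phi> x) i) (\<phi> ` (U \<inter> V)))"

text \<open>
  The atlas need not be maximal. Second countability is not required; it may be assumed in
  addition where it is part of the definition of a manifold. Connectedness is
  stated separately.
\<close>

definition complex_manifold :: "nat \<Rightarrow> 'a topology \<Rightarrow> 'a chart set \<Rightarrow> bool" where
  "complex_manifold d X \<A> \<longleftrightarrow>
     Hausdorff_space X \<and>
     (\<forall>C\<in>\<A>. is_chart d X C) \<and>
     (\<Union>C\<in>\<A>. fst C) = topspace X \<and>
     (\<forall>C\<in>\<A>. \<forall>C'\<in>\<A>. holomorphic_transition d C C')"

definition holomorphic_functions_to_disc :: "nat \<Rightarrow> 'a topology \<Rightarrow> 'a chart set \<Rightarrow> ('a \<Rightarrow> complex) set" where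
  "holomorphic_functions_to_disc d X \<A> =
     {f. (\<forall>(U, \<phi>)\<in>\<A>. cholomorphic_on d (\<lambda>x. f (inv_into U \<phi> x)) (\<phi> ` U)) \<and>
         f ` topspace X \<subseteq> ball 0 1}"


section \<open>Powers and symmetric powers\<close>

definition power_space :: "nat \<Rightarrow> 'a topology \<Rightarrow> (nat \<Rightarrow> 'a) topology" where
  "power_space n X = product_topology (\<lambda>_. X) {..<n}"

text \<open>
  The products of charts; coordinate \<open>j\<close> of the \<open>i\<close>-th factor becomes
  coordinate \<open>i * d + j\<close> of the product.
\<close>

definition power_atlas :: "nat \<Rightarrow> nat \<Rightarrow> 'a chart set \<Rightarrow> (nat \<Rightarrow> 'a) chart set" where
  "power_atlas n d \<A> =
     {(\<Pi>\<^sub>E i\<in>{..<n}. fst (C i), \<lambda>z. \<lambda>k\<in>{..<n * d}. snd (C (k div d)) (z (k div d)) (k mod d)) |C.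
        \<forall>i<n. C i \<in> \<A>}"

definition perm_rel :: "nat \<Rightarrow> 'a topology \<Rightarrow> ((nat \<Rightarrow> 'a) \<times> (nat \<Rightarrow> 'a)) set" where
  "perm_rel n X = {(z, w). z \<in> topspace (power_space n X) \<and> (\<exists>\<sigma>. \<sigma> permutes {..<n} \<and> w = z \<circ> \<sigma>)}"

definition sym_class :: "nat \<Rightarrow> 'a topology \<Rightarrow> (nat \<Rightarrow> 'a) \<Rightarrow> (nat \<Rightarrow> 'a) set" where
  "sym_class n X z = perm_rel n X `` {z}"

definition sym_power :: "nat \<Rightarrow> 'a topology \<Rightarrow> (nat \<Rightarrow> 'a) set topology" where
  "sym_power n X =
     topology (\<lambda>W. W \<subseteq> topspace (power_space n X) // perm_rel n X \<and> openin (power_space n X) (\<Union>W))"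

definition symmetric_functions_to_disc ::
    "nat \<Rightarrow> nat \<Rightarrow> 'a topology \<Rightarrow> 'a chart set \<Rightarrow> ((nat \<Rightarrow> 'a) \<Rightarrow> complex) set" where
  "symmetric_functions_to_disc n d X \<A> =
     {F \<in> holomorphic_functions_to_disc (n * d) (power_space n X) (power_atlas n d \<A>).
        \<forall>z\<in>topspace (power_space n X). \<forall>\<sigma>. \<sigma> permutes {..<n} \<longrightarrow> F (z \<circ> \<sigma>) = F z}"


section \<open>Caratheodory pseudodistances\<close>

definition poincare_dist :: "complex \<Rightarrow> complex \<Rightarrow> real" where
  "poincare_dist a b = artanh (norm ((a - b) / (1 - cnj a * b)))"

text \<open>The suprema are taken in the extended reals, so no boundedness is presupposed.\<close>

definition caratheodory :: "nat \<Rightarrow> 'a topology \<Rightarrow> 'a chart set \<Rightarrow> 'a \<Rightarrow> 'a \<Rightarrow> ereal" where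
  "caratheodory d X \<A> z w =
     Sup {ereal (poincare_dist 0 (f w)) |f. f \<in> holomorphic_functions_to_disc d X \<A> \<and> f z = 0}"

text \<open>
  The arguments are classes; by symmetry of \<open>F\<close> the choice of the representatives
  \<open>z\<close> and \<open>w\<close> is immaterial, see \<open>sym_caratheodory_sym_class\<close> below.
\<close>

definition sym_caratheodory ::
    "nat \<Rightarrow> nat \<Rightarrow> 'a topology \<Rightarrow> 'a chart set \<Rightarrow> (nat \<Rightarrow> 'a) set \<Rightarrow> (nat \<Rightarrow> 'a) set \<Rightarrow> ereal" where
  "sym_caratheodory n d X \<A> P Q =
     Sup {ereal (poincare_dist 0 (F w)) |F z w.
            F \<in> symmetric_functions_to_disc n d X \<A> \<and> z \<in> P \<and> w \<in> Q \<and> F z = 0}"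

text \<open>
  An accumulation point of a sequence (not of its range): constant sequences have one.
\<close>

definition accumulation_point :: "'z topology \<Rightarrow> (nat \<Rightarrow> 'z) \<Rightarrow> 'z \<Rightarrow> bool" where
  "accumulation_point Z s a \<longleftrightarrow>
     a \<in> topspace Z \<and> (\<forall>U. openin Z U \<and> a \<in> U \<longrightarrow> infinite {k. s k \<in> U})"

definition quasi_finitely_compact :: "'z topology \<Rightarrow> ('z \<Rightarrow> 'z \<Rightarrow> ereal) \<Rightarrow> bool" where
  "quasi_finitely_compact Z c \<longleftrightarrow>
     (\<forall>s. range s \<subseteq> topspace Z \<and> (\<nexists>a. accumulation_point Z s a) \<longrightarrow>
        (\<lambda>k. c (s 0) (s k)) \<longlonglongrightarrow> \<infinity>)"


section \<open>Basic properties\<close>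

lemma poincare_dist_0: "poincare_dist 0 \<sigma> = artanh (norm \<sigma>)"
  by (simp add: poincare_dist_def)

lemma comp_permutes_in_power_space:
  assumes "z \<in> topspace (power_space n X)" "\<sigma> permutes {..<n}"
  shows "z \<circ> \<sigma> \<in> topspace (power_space n X)"
proof -
  have "\<sigma> i < n \<longleftrightarrow> i < n" for i
    using permutes_in_image[OF assms(2), of i] by simp
  then show ?thesis
    using assms(1) by (auto simp: power_space_def PiE_iff extensional_def)
qed

lemma equiv_perm_rel: "equiv (topspace (power_space n X)) (perm_rel n X)"
proof (rule equivI)
  show "perm_rel n X \<subseteq> topspace (power_space n X) \<times> topspace (power_space n X)"
    by (auto simp: perm_rel_def comp_permutes_in_power_space)
  show "refl_on (topspace (power_space n X)) (perm_rel n X)"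
    unfolding refl_on_def perm_rel_def using permutes_id[of "{..<n}"]
    by (metis (mono_tags, lifting) case_prodI comp_id mem_Collect_eq)
  show "sym (perm_rel n X)"
  proof (rule symI)
    fix z w assume "(z, w) \<in> perm_rel n X"
    then obtain \<sigma> where z: "z \<in> topspace (power_space n X)" and \<sigma>: "\<sigma> permutes {..<n}"
      and w: "w = z \<circ> \<sigma>"
      by (auto simp: perm_rel_def)
    have "z = w \<circ> inv \<sigma>"
      using permutes_inv_o(1)[OF \<sigma>] by (simp add: w o_assoc [symmetric])
    then show "(w, z) \<in> perm_rel n X"
      using z \<sigma> w permutes_inv[OF \<sigma>] by (auto simp: perm_rel_def comp_permutes_in_power_space)
  qed
  show "trans (perm_rel n X)"
  proof (rule transI)
    fix x y z assume "(x, y) \<in> perm_rel n X" "(y, z) \<in> perm_rel n X"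
    then obtain \<sigma> \<tau> where x: "x \<in> topspace (power_space n X)"
      and \<sigma>\<tau>: "\<sigma> permutes {..<n}" "\<tau> permutes {..<n}" and z: "z = (x \<circ> \<sigma>) \<circ> \<tau>"
      unfolding perm_rel_def by blast
    have "\<sigma> \<circ> \<tau> permutes {..<n}"
      using \<sigma>\<tau>(2,1) by (rule permutes_compose)
    moreover have "z = x \<circ> (\<sigma> \<circ> \<tau>)"
      by (simp only: z o_assoc)
    ultimately show "(x, z) \<in> perm_rel n X"
      using x by (auto simp: perm_rel_def)
  qed
qed

lemma openin_sym_power:
  "openin (sym_power n X) W \<longleftrightarrow>
     W \<subseteq> topspace (power_space n X) // perm_rel n X \<and> openin (power_space n X) (\<Union>W)"
proof -
  let ?Q = "topspace (power_space n X) // perm_rel n X"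
  have "\<Union>(S \<inter> T) = \<Union>S \<inter> \<Union>T" if "S \<subseteq> ?Q" "T \<subseteq> ?Q" for S T
    using that quotient_disj[OF equiv_perm_rel[of n X]] by blast
  moreover have "openin (power_space n X) (\<Union>(\<Union>K))"
    if "\<forall>S\<in>K. openin (power_space n X) (\<Union>S)" for K
  proof -
    have "\<Union>(\<Union>K) = \<Union>(Union ` K)"
      by blast
    then show ?thesis
      using that by (metis (no_types, lifting) imageE openin_Union)
  qed
  ultimately have "istopology (\<lambda>W. W \<subseteq> ?Q \<and> openin (power_space n X) (\<Union>W))"
    unfolding istopology_def by (simp add: Sup_le_iff le_infI1 openin_Int)
  then show ?thesis
    by (simp add: sym_power_def topology_inverse')
qed

lemma quotient_map_sym_class: "quotient_map (power_space n X) (sym_power n X) (sym_class n X)"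
proof -
  let ?T = "topspace (power_space n X)"
  let ?Q = "?T // perm_rel n X"
  have Un: "\<Union>?Q = ?T"
    by (rule Union_quotient[OF equiv_perm_rel])
  have top: "topspace (sym_power n X) = ?Q"
  proof (rule antisym)
    show "topspace (sym_power n X) \<subseteq> ?Q"
      using openin_topspace[of "sym_power n X"] unfolding openin_sym_power by (rule conjunct1)
    have "openin (sym_power n X) ?Q"
      unfolding openin_sym_power Un by simp
    then show "?Q \<subseteq> topspace (sym_power n X)"
      by (rule openin_subset)
  qed
  have pre: "{z \<in> ?T. sym_class n X z \<in> W} = \<Union>W" if "W \<subseteq> ?Q" for W
  proof -
    have mem: "P = sym_class n X z" if "P \<in> ?Q" "z \<in> P" for P z
      using that equiv_perm_rel[of n X]
      by (metis sym_class_def Image_singleton_iff equiv_class_eq quotientE)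
    have self: "z \<in> sym_class n X z" if "z \<in> ?T" for z
      unfolding sym_class_def by (rule equiv_class_self[OF equiv_perm_rel that])
    show ?thesis
    proof (intro set_eqI iffI)
      fix z assume "z \<in> {z \<in> ?T. sym_class n X z \<in> W}"
      then show "z \<in> \<Union>W"
        using self by blast
    next
      fix z assume "z \<in> \<Union>W"
      then obtain P where P: "P \<in> W" "z \<in> P"
        by blast
      then have "P \<in> ?Q"
        using that by blast
      then have "z \<in> ?T" "P = sym_class n X z"
        using P Un mem by blast+
      then show "z \<in> {z \<in> ?T. sym_class n X z \<in> W}"
        using P by simp
    qed
  qed
  show ?thesis
    unfolding quotient_map_def top
    using pre by (auto simp: openin_sym_power quotient_def sym_class_def)
qed

lemma sym_caratheodory_sym_class:
  assumes "z \<in> topspace (power_space n X)" "w \<in> topspace (power_space n X)"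
  shows "sym_caratheodory n d X \<A> (sym_class n X z) (sym_class n X w) =
           Sup {ereal (poincare_dist 0 (F w)) |F. F \<in> symmetric_functions_to_disc n d X \<A> \<and> F z = 0}"
proof -
  have *: "F z' = F z" if "F \<in> symmetric_functions_to_disc n d X \<A>" "z' \<in> sym_class n X z" for F z z'
    using that by (auto simp: symmetric_functions_to_disc_def sym_class_def perm_rel_def)
  have self: "z \<in> sym_class n X z" "w \<in> sym_class n X w"
    unfolding sym_class_def by (rule equiv_class_self[OF equiv_perm_rel], fact)+
  have "(\<exists>F z' w'. u = ereal (poincare_dist 0 (F w')) \<and> F \<in> symmetric_functions_to_disc n d X \<A> \<and>
           z' \<in> sym_class n X z \<and> w' \<in> sym_class n X w \<and> F z' = 0) \<longleftrightarrow>
        (\<exists>F. u = ereal (poincare_dist 0 (F w)) \<and> F \<in> symmetric_functions_to_disc n d X \<A> \<and> F z = 0)"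
    for u
    using * self by metis
  then show ?thesis
    by (simp add: sym_caratheodory_def)
qed

end

theory Submission
  imports Defs
begin

text \<open>
  If the symmetric power is quasi \<open>c\<close>-finitely compact, restrict symmetric functions to the
  diagonal \<open>\<langle>x, \<dots>, x\<rangle>\<close>. Conversely, a sequence in the symmetric power without accumulation point
  has, after passing to a subsequence, a coordinate \<open>w\<^sub>k\<close> without accumulation point in \<open>X\<close>, since
  charts make \<open>X\<close> first countable. For a base point \<open>\<langle>a\<^sub>1, \<dots>, a\<^sub>n\<rangle>\<close> choose functions vanishing at
  \<open>a\<^sub>j\<close> and of modulus close to 1 at \<open>w\<^sub>k\<close>; their product \<open>h\<close> vanishes at all \<open>a\<^sub>j\<close>, and after a
  rotation \<open>h w\<^sub>k\<close> is close to 1. Transport \<open>h\<close> to the right half-plane by the Cayley transform,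
  average it over the coordinates and transport back: the resulting symmetric function vanishes at
  the base point and has modulus close to 1 along the sequence.
\<close>

section \<open>Complex differentiability in coordinates\<close>

text \<open>Written without a quotient, so that \<open>z = a\<close> need not be excluded from the neighbourhood.\<close>

definition has_cderivative ::
    "nat \<Rightarrow> ((nat \<Rightarrow> complex) \<Rightarrow> complex) \<Rightarrow> (nat \<Rightarrow> complex) \<Rightarrow> (nat \<Rightarrow> complex) \<Rightarrow> bool" where
  "has_cderivative d f c a \<longleftrightarrow>
     (\<forall>\<epsilon>>0. \<forall>\<^sub>F z in nhdsin (cspace d) a.
        norm (f z - f a - (\<Sum>i<d. c i * (z i - a i))) \<le> \<epsilon> * (\<Sum>i<d. norm (z i - a i)))"

lemma topspace_cspace: "topspace (cspace d) = extensional {..<d}"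
  by (auto simp: cspace_def PiE_def)

lemma sum_norm_diff_pos:
  fixes a z :: "nat \<Rightarrow> complex"
  assumes "a \<in> extensional {..<d}" "z \<in> extensional {..<d}" "z \<noteq> a"
  shows "(\<Sum>i<d. norm (z i - a i)) > 0"
proof -
  obtain i where i: "i < d" "z i \<noteq> a i"
    using assms by (metis extensionalityI lessThan_iff)
  have "0 < norm (z i - a i)"
    using i by simp
  also have "\<dots> \<le> (\<Sum>i<d. norm (z i - a i))"
    using i by (intro member_le_sum) auto
  finally show ?thesis .
qed

text \<open>Adding the centre \<open>a\<close> is harmless, since both sides of the inequality
  vanish there. Away from \<open>a\<close> the denominator is positive, because points of
  \<open>cspace d\<close> are extensional and so differ in some coordinate below
  \<open>d\<close>.\<close>

lemma has_cderivative_iff_tendsto: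
  "has_cderivative d f c a \<longleftrightarrow>
     ((\<lambda>z. norm (f z - f a - (\<Sum>i<d. c i * (z i - a i))) / (\<Sum>i<d. norm (z i - a i))) \<longlongrightarrow> 0)
       (atin (cspace d) a)"
  (is "_ \<longleftrightarrow> (?q \<longlongrightarrow> 0) _")
proof (cases "a \<in> topspace (cspace d)")
  \<comment> \<open>Both filters are trivial at a point outside the space.\<close>
  case False
  then show ?thesis
    by (simp add: has_cderivative_def)
next
  case True
  let ?E = "\<lambda>z. norm (f z - f a - (\<Sum>i<d. c i * (z i - a i)))"
  let ?N = "\<lambda>z. (\<Sum>i<d. norm (z i - a i))"
  have q: "?q z \<le> \<epsilon> \<longleftrightarrow> ?E z \<le> \<epsilon> * ?N z" if "z \<in> topspace (cspace d)" "z \<noteq> a" for z \<epsilon>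
    using sum_norm_diff_pos[of a d z] that True by (simp add: topspace_cspace pos_divide_le_eq)
  have ev: "(\<forall>\<^sub>F z in atin (cspace d) a. ?q z \<le> \<epsilon>) \<longleftrightarrow>
        (\<forall>\<^sub>F z in nhdsin (cspace d) a. ?E z \<le> \<epsilon> * ?N z)" for \<epsilon>
  proof -
    have "(\<forall>z\<in>S - {a}. ?q z \<le> \<epsilon>) \<longleftrightarrow> (\<forall>z\<in>S. ?E z \<le> \<epsilon> * ?N z)"
      if "openin (cspace d) S" for S
    proof -
      have "(\<forall>z\<in>S - {a}. ?q z \<le> \<epsilon>) \<longleftrightarrow> (\<forall>z\<in>S - {a}. ?E z \<le> \<epsilon> * ?N z)"
        using q openin_subset[OF that] by blast
      also have "\<dots> \<longleftrightarrow> (\<forall>z\<in>S. ?E z \<le> \<epsilon> * ?N z)"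
        by auto
      finally show ?thesis .
    qed
    then show ?thesis
      unfolding eventually_nhdsin eventually_atin using True by meson
  qed
  have nonneg: "?q z \<ge> 0" for z
    by (simp add: sum_nonneg)
  have "(?q \<longlongrightarrow> 0) (atin (cspace d) a) \<longleftrightarrow>
      (\<forall>\<epsilon>>0. \<forall>\<^sub>F z in atin (cspace d) a. ?q z < \<epsilon>)"
    unfolding tendsto_iff dist_real_def diff_0_right abs_of_nonneg[OF nonneg] ..
  also have "\<dots> \<longleftrightarrow> (\<forall>\<epsilon>>0. \<forall>\<^sub>F z in atin (cspace d) a. ?q z \<le> \<epsilon>)"
  proof (intro iffI allI impI)
    fix \<epsilon> :: real
    assume "\<forall>\<epsilon>>0. \<forall>\<^sub>F z in atin (cspace d) a. ?q z \<le> \<epsilon>" "\<epsilon> > 0"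
    \<comment> \<open>Halving \<epsilon> turns the weak inequality into the strict one required by
      \<open>tendsto_iff\<close>.\<close>
    then have "\<forall>\<^sub>F z in atin (cspace d) a. ?q z \<le> \<epsilon> / 2"
      using half_gt_zero by blast
    then show "\<forall>\<^sub>F z in atin (cspace d) a. ?q z < \<epsilon>"
      by (rule eventually_mono) (use \<open>\<epsilon> > 0\<close> in linarith)
  qed (blast intro: eventually_mono less_imp_le)
  finally show ?thesis
    unfolding has_cderivative_def ev by simp
qed

lemma cholomorphic_on_iff: "cholomorphic_on d f V \<longleftrightarrow> (\<forall>a\<in>V. \<exists>c. has_cderivative d f c a)"
  by (simp add: cholomorphic_on_def has_cderivative_iff_tendsto)

text \<open>Openness of \<open>V\<close> matters: differentiability at a point depends on the values
  in a whole neighbourhood, not just on the point itself.\<close>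

lemma cholomorphic_on_cong:
  assumes "openin (cspace d) V" "\<And>x. x \<in> V \<Longrightarrow> f x = g x" "cholomorphic_on d f V"
  shows "cholomorphic_on d g V"
  unfolding cholomorphic_on_iff
proof
  fix a assume a: "a \<in> V"
  then obtain c where c: "has_cderivative d f c a"
    using assms(3) cholomorphic_on_iff by blast
  have V: "\<forall>\<^sub>F z in nhdsin (cspace d) a. z \<in> V"
    using assms(1) a by (auto simp: eventually_nhdsin)
  have "has_cderivative d g c a"
    unfolding has_cderivative_def
  proof (intro allI impI)
    fix \<epsilon> :: real assume "\<epsilon> > 0"
    then have "\<forall>\<^sub>F z in nhdsin (cspace d) a.
        norm (f z - f a - (\<Sum>i<d. c i * (z i - a i))) \<le> \<epsilon> * (\<Sum>i<d. norm (z i - a i))"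
      using c by (simp add: has_cderivative_def)
    with V show "\<forall>\<^sub>F z in nhdsin (cspace d) a.
        norm (g z - g a - (\<Sum>i<d. c i * (z i - a i))) \<le> \<epsilon> * (\<Sum>i<d. norm (z i - a i))"
      by eventually_elim (use assms(2) a in simp)
  qed
  then show "\<exists>c. has_cderivative d g c a"
    by blast
qed

lemma cholomorphic_on_const: "cholomorphic_on d (\<lambda>_. k) V"
proof -
  have "has_cderivative d (\<lambda>_. k) (\<lambda>_. 0) a" for a
    by (simp add: has_cderivative_def sum_nonneg)
  then show ?thesis
    unfolding cholomorphic_on_iff by blast
qed

lemma cholomorphic_on_add:
  assumes "cholomorphic_on d f V" "cholomorphic_on d g V"
  shows "cholomorphic_on d (\<lambda>x. f x + g x) V"
  unfolding cholomorphic_on_iff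
proof
  fix a assume a: "a \<in> V"
  obtain b c where b: "has_cderivative d f b a" and c: "has_cderivative d g c a"
    using assms a by (meson cholomorphic_on_iff)
  have "has_cderivative d (\<lambda>x. f x + g x) (\<lambda>i. b i + c i) a"
    unfolding has_cderivative_def
  proof (intro allI impI)
    fix \<epsilon> :: real assume "\<epsilon> > 0"
    then have h: "\<epsilon> / 2 > 0"
      by simp
    show "\<forall>\<^sub>F z in nhdsin (cspace d) a.
        norm (f z + g z - (f a + g a) - (\<Sum>i<d. (b i + c i) * (z i - a i))) \<le>
          \<epsilon> * (\<Sum>i<d. norm (z i - a i))"
      using b[unfolded has_cderivative_def, rule_format, OF h]
        c[unfolded has_cderivative_def, rule_format, OF h]
    proof eventually_elim
      case (elim z)
      have "f z + g z - (f a + g a) - (\<Sum>i<d. (b i + c i) * (z i - a i)) =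
          (f z - f a - (\<Sum>i<d. b i * (z i - a i))) + (g z - g a - (\<Sum>i<d. c i * (z i - a i)))"
        by (simp add: distrib_right sum.distrib)
      also have "norm \<dots> \<le> \<epsilon> / 2 * (\<Sum>i<d. norm (z i - a i)) + \<epsilon> / 2 * (\<Sum>i<d. norm (z i - a i))"
        by (rule norm_triangle_mono[OF elim])
      finally show ?case
        by simp
    qed
  qed
  then show "\<exists>c. has_cderivative d (\<lambda>x. f x + g x) c a"
    by blast
qed

lemma tendsto_sum_norm_diff_nhdsin_cspace:
  "((\<lambda>z. \<Sum>i<d. norm (z i - a i)) \<longlongrightarrow> 0) (nhdsin (cspace d) a)"
proof (cases "a \<in> topspace (cspace d)")
  case False
  then show ?thesis by simp
next
  case True
  have "((\<lambda>z. norm (z i - a i)) \<longlongrightarrow> 0) (nhdsin (cspace d) a)" if "i < d" for i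
  proof (rule tendstoI)
    fix e :: real assume "e > 0"
    have "continuous_map (cspace d) euclidean (\<lambda>z. z i)"
      unfolding cspace_def using that by (intro continuous_map_product_projection) simp
    then have "openin (cspace d) {z \<in> topspace (cspace d). z i \<in> ball (a i) e}"
      by (rule openin_continuous_map_preimage) simp
    then show "\<forall>\<^sub>F z in nhdsin (cspace d) a. dist (norm (z i - a i)) 0 < e"
      using True \<open>e > 0\<close> unfolding eventually_nhdsin
      by (intro disjI2 exI[of _ "{z \<in> topspace (cspace d). z i \<in> ball (a i) e}"])
        (auto simp: dist_norm norm_minus_commute)
  qed
  then show ?thesis
    by (intro tendsto_null_sum) auto
qed

text \<open>The error splits into the remainder of \<open>g\<close> at \<open>f z\<close> and
  \<open>g'\<close> times the remainder of \<open>f\<close> at \<open>z\<close>. Each part is kept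
  below half of the allowed error.\<close>

lemma has_cderivative_compose_field:
  assumes f: "has_cderivative d f c a" and g: "(g has_field_derivative g') (at (f a))"
  shows "has_cderivative d (\<lambda>x. g (f x)) (\<lambda>i. g' * c i) a"
  unfolding has_cderivative_def
proof (intro allI impI)
  fix \<epsilon> :: real assume \<epsilon>: "\<epsilon> > 0"
  let ?N = "\<lambda>z. (\<Sum>i<d. norm (z i - a i))"
  \<comment> \<open>\<open>K\<close> is a Lipschitz constant of \<open>f\<close> at
    \<open>a\<close>: the sum bounds the linear part, and the 1 is the remainder estimate taken with
    \<epsilon> = 1.\<close>
  define K where "K = 1 + (\<Sum>i<d. norm (c i))"
  have K: "K > 0"
    unfolding K_def by (simp add: add_pos_nonneg sum_nonneg)
  \<comment> \<open>The denominator uses \<open>1 + norm g'\<close> because \<open>g'\<close> may be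
    zero.\<close>
  have \<eta>: "\<epsilon> / (2 * K) > 0" and \<epsilon>1: "\<epsilon> / (2 * (1 + norm g')) > 0"
    using \<epsilon> K by (simp_all add: add_pos_nonneg)
  obtain \<delta> where \<delta>: "\<delta> > 0"
    "\<And>w. norm (w - f a) < \<delta> \<Longrightarrow> norm (g w - g (f a) - g' * (w - f a)) \<le> \<epsilon> / (2 * K) * norm (w - f a)"
    using g \<eta> unfolding has_field_derivative_def has_derivative_at_alt by metis
  have "\<forall>\<^sub>F z in nhdsin (cspace d) a. ?N z < \<delta> / K"
    using order_tendstoD(2)[OF tendsto_sum_norm_diff_nhdsin_cspace] \<delta>(1) K by simp
  with f[unfolded has_cderivative_def, rule_format, OF zero_less_one]
    f[unfolded has_cderivative_def, rule_format, OF \<epsilon>1]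
  show "\<forall>\<^sub>F z in nhdsin (cspace d) a.
      norm (g (f z) - g (f a) - (\<Sum>i<d. g' * c i * (z i - a i))) \<le> \<epsilon> * ?N z"
  proof eventually_elim
    case (elim z)
    let ?L = "\<Sum>i<d. c i * (z i - a i)"
    have "norm ?L \<le> (\<Sum>i<d. norm (c i) * ?N z)"
      by (intro sum_norm_le) (auto simp: norm_mult intro!: mult_left_mono member_le_sum)
    then have "norm (f z - f a) \<le> K * ?N z"
      using elim(1) norm_triangle_ineq[of "f z - f a - ?L" ?L]
      by (simp add: K_def sum_distrib_right algebra_simps)
    moreover have "K * ?N z < \<delta>"
      using elim(3) K by (simp add: field_simps)
    ultimately have "norm (g (f z) - g (f a) - g' * (f z - f a)) \<le> \<epsilon> / (2 * K) * (K * ?N z)"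
      using \<delta>(2)[of "f z"] \<eta> by (meson le_less_trans less_imp_le mult_left_mono order_trans)
    then have 1: "norm (g (f z) - g (f a) - g' * (f z - f a)) \<le> \<epsilon> / 2 * ?N z"
      using K by simp
    have "norm (g' * (f z - f a - ?L)) \<le> norm g' * (\<epsilon> / (2 * (1 + norm g')) * ?N z)"
      unfolding norm_mult using elim(2) by (rule mult_left_mono) simp
    also have "\<dots> = (norm g' / (1 + norm g')) * (\<epsilon> / 2 * ?N z)"
      by simp
    also have "\<dots> \<le> 1 * (\<epsilon> / 2 * ?N z)"
      using \<epsilon> by (intro mult_right_mono) (auto simp: sum_nonneg divide_le_eq_1 add_pos_nonneg)
    finally have 2: "norm (g' * (f z - f a - ?L)) \<le> \<epsilon> / 2 * ?N z"
      by simp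
    have "g (f z) - g (f a) - (\<Sum>i<d. g' * c i * (z i - a i)) =
        (g (f z) - g (f a) - g' * (f z - f a)) + g' * (f z - f a - ?L)"
      by (simp add: algebra_simps sum_distrib_left)
    also have "norm \<dots> \<le> \<epsilon> / 2 * ?N z + \<epsilon> / 2 * ?N z"
      by (rule norm_triangle_mono[OF 1 2])
    finally show ?case
      by simp
  qed
qed

lemma cholomorphic_on_compose_field:
  assumes "cholomorphic_on d f V" "\<And>a. a \<in> V \<Longrightarrow> g field_differentiable (at (f a))"
  shows "cholomorphic_on d (\<lambda>x. g (f x)) V"
  using assms has_cderivative_compose_field unfolding cholomorphic_on_iff field_differentiable_def
  by meson

lemma cholomorphic_on_cmult:
  assumes "cholomorphic_on d f V"
  shows "cholomorphic_on d (\<lambda>x. k * f x) V"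
  by (rule cholomorphic_on_compose_field[OF assms]) (intro derivative_intros)

text \<open>By polarization, only composition with the square function is needed.\<close>

lemma cholomorphic_on_mult:
  assumes "cholomorphic_on d f V" "cholomorphic_on d g V"
  shows "cholomorphic_on d (\<lambda>x. f x * g x) V"
proof -
  have square: "cholomorphic_on d (\<lambda>x. (f x + k * g x)\<^sup>2) V" for k
    by (rule cholomorphic_on_compose_field[where g = "\<lambda>w. w\<^sup>2"])
      (intro cholomorphic_on_add cholomorphic_on_cmult assms derivative_intros)+
  have "(\<lambda>x. f x * g x) = (\<lambda>x. (1/4) * (f x + 1 * g x)\<^sup>2 + (-1/4) * (f x + (-1) * g x)\<^sup>2)"
    by (auto simp: power2_eq_square algebra_simps)
  then show ?thesis
    by (simp only:) (intro cholomorphic_on_add cholomorphic_on_cmult square)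
qed

lemma cholomorphic_on_sum:
  assumes "\<And>i. i \<in> I \<Longrightarrow> cholomorphic_on d (f i) V"
  shows "cholomorphic_on d (\<lambda>x. \<Sum>i\<in>I. f i x) V"
  using assms
  by (induction I rule: infinite_finite_induct) (auto intro: cholomorphic_on_const cholomorphic_on_add)

lemma cholomorphic_on_prod:
  assumes "\<And>i. i \<in> I \<Longrightarrow> cholomorphic_on d (f i) V"
  shows "cholomorphic_on d (\<lambda>x. \<Prod>i\<in>I. f i x) V"
  using assms
  by (induction I rule: infinite_finite_induct) (auto intro: cholomorphic_on_const cholomorphic_on_mult)

section \<open>Selection of coordinates\<close>

text \<open>One device covers both coordinate changes that occur: the projection to block
  \<open>i\<close> of a product chart, with \<rho> j = i * d + j, and the diagonal embedding, with
  \<rho> k = k mod d.\<close>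

definition reindex :: "nat \<Rightarrow> (nat \<Rightarrow> nat) \<Rightarrow> (nat \<Rightarrow> complex) \<Rightarrow> nat \<Rightarrow> complex" where
  "reindex m \<rho> x = (\<lambda>k\<in>{..<m}. x (\<rho> k))"

lemma continuous_map_reindex:
  assumes "\<And>k. k < m \<Longrightarrow> \<rho> k < D"
  shows "continuous_map (cspace D) (cspace m) (reindex m \<rho>)"
  unfolding cspace_def continuous_map_componentwise reindex_def
  using assms by (auto intro!: continuous_map_product_projection)

text \<open>This is the chain rule for a linear map. Since \<rho> may repeat a coordinate, as on the
  diagonal, the coefficient of coordinate \<open>i\<close> collects all \<open>c k\<close> with
  \<rho> k = i.\<close>

lemma cholomorphic_on_reindex:
  assumes \<rho>: "\<And>k. k < m \<Longrightarrow> \<rho> k < D"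
    and f: "cholomorphic_on m f V" and W: "W \<subseteq> topspace (cspace D)" "reindex m \<rho> ` W \<subseteq> V"
  shows "cholomorphic_on D (\<lambda>x. f (reindex m \<rho> x)) W"
  unfolding cholomorphic_on_iff
proof
  fix a assume a: "a \<in> W"
  let ?L = "reindex m \<rho>"
  obtain c where c: "has_cderivative m f c (?L a)"
    using f W(2) a unfolding cholomorphic_on_iff by blast
  have a': "a \<in> topspace (cspace D)"
    using a W by blast
  have cont: "continuous_map (cspace D) (cspace m) ?L"
    by (rule continuous_map_reindex[OF \<rho>])
  have ev: "\<forall>\<^sub>F x in nhdsin (cspace D) a. P (?L x)" if "\<forall>\<^sub>F y in nhdsin (cspace m) (?L a). P y" for P
  proof -
    have "?L a \<in> topspace (cspace m)"
      by (simp add: topspace_cspace reindex_def)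
    then obtain S where S: "openin (cspace m) S" "?L a \<in> S" "\<forall>y\<in>S. P y"
      using \<open>\<forall>\<^sub>F y in nhdsin (cspace m) (?L a). P y\<close> by (auto simp: eventually_nhdsin)
    have "openin (cspace D) {x \<in> topspace (cspace D). ?L x \<in> S}"
      by (rule openin_continuous_map_preimage[OF cont S(1)])
    then show ?thesis
      using S a' unfolding eventually_nhdsin by blast
  qed
  have "has_cderivative D (\<lambda>x. f (?L x)) (\<lambda>i. \<Sum>k\<in>{k\<in>{..<m}. \<rho> k = i}. c k) a"
    unfolding has_cderivative_def
  proof (intro allI impI)
    fix \<epsilon> :: real assume "\<epsilon> > 0"
    \<comment> \<open>The selection enlarges the norm by a factor of at most \<open>m\<close>;
      adding 1 keeps the denominator positive for m = 0.\<close>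
    then have "\<epsilon> / (real m + 1) > 0"
      by simp
    from c[unfolded has_cderivative_def, rule_format, OF this, THEN ev]
    show "\<forall>\<^sub>F x in nhdsin (cspace D) a.
        norm (f (?L x) - f (?L a) - (\<Sum>i<D. (\<Sum>k\<in>{k\<in>{..<m}. \<rho> k = i}. c k) * (x i - a i)))
          \<le> \<epsilon> * (\<Sum>i<D. norm (x i - a i))"
    proof eventually_elim
      case (elim x)
      let ?N = "\<Sum>i<D. norm (x i - a i)"
      have "(\<Sum>i<D. (\<Sum>k\<in>{k\<in>{..<m}. \<rho> k = i}. c k) * (x i - a i)) =
          (\<Sum>i<D. \<Sum>k\<in>{k\<in>{..<m}. \<rho> k = i}. c k * (x (\<rho> k) - a (\<rho> k)))"
        by (simp add: sum_distrib_right)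
      also have "\<dots> = (\<Sum>k<m. c k * (x (\<rho> k) - a (\<rho> k)))"
        using \<rho> by (intro sum.group) auto
      also have "\<dots> = (\<Sum>k<m. c k * (?L x k - ?L a k))"
        by (simp add: reindex_def)
      finally have lin: "(\<Sum>i<D. (\<Sum>k\<in>{k\<in>{..<m}. \<rho> k = i}. c k) * (x i - a i)) = \<dots>" .
      have "(\<Sum>k<m. norm (?L x k - ?L a k)) \<le> (\<Sum>k<m. ?N)"
        using \<rho> by (intro sum_mono) (auto simp: reindex_def intro!: member_le_sum)
      also have "\<dots> \<le> (real m + 1) * ?N"
        by (simp add: sum_nonneg algebra_simps)
      finally have "\<epsilon> / (real m + 1) * (\<Sum>k<m. norm (?L x k - ?L a k)) \<le>
          \<epsilon> / (real m + 1) * ((real m + 1) * ?N)"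
        using \<open>\<epsilon> / (real m + 1) > 0\<close> by (intro mult_left_mono) auto
      also have "\<dots> = \<epsilon> * ?N"
        by simp
      finally show ?case
        using elim unfolding lin by linarith
    qed
  qed
  then show "\<exists>c. has_cderivative D (\<lambda>x. f (?L x)) c a"
    by blast
qed


section \<open>Sequences and accumulation points\<close>

lemma strict_mono_artanh:
  fixes x y :: real
  assumes "-1 < x" "x < y" "y < 1"
  shows "artanh x < artanh y"
proof -
  have "(1 + x) / (1 - x) < (1 + y) / (1 - y)"
    using assms by (simp add: field_simps)
  moreover have "0 < (1 + x) / (1 - x)"
    using assms by simp
  ultimately show ?thesis
    by (simp add: artanh_def)
qed

text \<open>Since \<open>artanh\<close> increases from 0 to infinity on [0, 1), divergence of the
  suprema means that values of modulus arbitrarily close to 1 occur. From here on, both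
  pseudodistances are handled through such values only.\<close>

lemma SUP_poincare_dist_tendsto_PInfty_iff:
  assumes "\<And>k. A k \<subseteq> ball 0 1"
  shows "((\<lambda>k. SUP v\<in>A k. ereal (poincare_dist 0 v)) \<longlongrightarrow> \<infinity>) F \<longleftrightarrow>
    (\<forall>t<1. \<forall>\<^sub>F k in F. \<exists>v\<in>A k. t < norm v)"
  unfolding tendsto_PInfty less_SUP_iff poincare_dist_0 less_ereal.simps
proof (intro iffI allI impI)
  fix t :: real
  assume lim: "\<forall>r. \<forall>\<^sub>F k in F. \<exists>v\<in>A k. r < artanh (norm v)" and "t < 1"
  \<comment> \<open>A threshold \<open>t\<close> below 0 is replaced by 0, to stay in the range
    where \<open>artanh\<close> is monotone.\<close>
  have "\<forall>\<^sub>F k in F. \<exists>v\<in>A k. artanh (max t 0) < artanh (norm v)"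
    using lim by blast
  then show "\<forall>\<^sub>F k in F. \<exists>v\<in>A k. t < norm v"
  proof (rule eventually_mono)
    fix k assume "\<exists>v\<in>A k. artanh (max t 0) < artanh (norm v)"
    then obtain v where v: "v \<in> A k" "artanh (max t 0) < artanh (norm v)"
      by blast
    have "\<not> norm v < max t 0"
      using strict_mono_artanh[of "norm v" "max t 0"] v(2) \<open>t < 1\<close> norm_ge_zero[of v] by linarith
    moreover have "norm v \<noteq> max t 0"
      using v(2) by auto
    ultimately have "t < norm v"
      by linarith
    then show "\<exists>v\<in>A k. t < norm v"
      using v(1) by blast
  qed
next
  fix r :: real
  assume lim: "\<forall>t<1. \<forall>\<^sub>F k in F. \<exists>v\<in>A k. t < norm v"
  have "\<forall>\<^sub>F k in F. \<exists>v\<in>A k. tanh r < norm v"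
    using lim tanh_real_lt_1 by blast
  then show "\<forall>\<^sub>F k in F. \<exists>v\<in>A k. r < artanh (norm v)"
  proof (rule eventually_mono)
    fix k assume "\<exists>v\<in>A k. tanh r < norm v"
    then obtain v where v: "v \<in> A k" "tanh r < norm v"
      by blast
    then have "artanh (tanh r) < artanh (norm v)"
      using assms[of k] by (intro strict_mono_artanh tanh_real_gt_neg1) auto
    then show "\<exists>v\<in>A k. r < artanh (norm v)"
      using v(1) by (auto simp: artanh_tanh_real)
  qed
qed

lemma caratheodory_tendsto_PInfty_iff:
  assumes "\<And>k. w k \<in> topspace X"
  shows "((\<lambda>k. caratheodory d X \<A> z (w k)) \<longlongrightarrow> \<infinity>) G \<longleftrightarrow>
    (\<forall>t<1. \<forall>\<^sub>F k in G. \<exists>f\<in>holomorphic_functions_to_disc d X \<A>. f z = 0 \<and> t < norm (f (w k)))"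
proof -
  let ?A = "\<lambda>k. {f (w k) |f. f \<in> holomorphic_functions_to_disc d X \<A> \<and> f z = 0}"
  have "caratheodory d X \<A> z (w k) = (SUP v\<in>?A k. ereal (poincare_dist 0 v))" for k
    unfolding caratheodory_def by (rule arg_cong[of _ _ Sup]) blast
  moreover have "?A k \<subseteq> ball 0 1" for k
    using assms[of k] by (auto simp: holomorphic_functions_to_disc_def simp del: mem_ball)
  moreover have "(\<exists>v\<in>?A k. t < norm v) \<longleftrightarrow>
      (\<exists>f\<in>holomorphic_functions_to_disc d X \<A>. f z = 0 \<and> t < norm (f (w k)))" for k t
    by blast
  ultimately show ?thesis
    using SUP_poincare_dist_tendsto_PInfty_iff[of ?A G] by simp
qed

lemma sym_caratheodory_tendsto_PInfty_iff:
  assumes "z \<in> topspace (power_space n X)" "\<And>k. w k \<in> topspace (power_space n X)"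
  shows "((\<lambda>k. sym_caratheodory n d X \<A> (sym_class n X z) (sym_class n X (w k))) \<longlongrightarrow> \<infinity>) G \<longleftrightarrow>
    (\<forall>t<1. \<forall>\<^sub>F k in G. \<exists>F\<in>symmetric_functions_to_disc n d X \<A>. F z = 0 \<and> t < norm (F (w k)))"
proof -
  let ?A = "\<lambda>k. {F (w k) |F. F \<in> symmetric_functions_to_disc n d X \<A> \<and> F z = 0}"
  have "sym_caratheodory n d X \<A> (sym_class n X z) (sym_class n X (w k)) =
      (SUP v\<in>?A k. ereal (poincare_dist 0 v))" for k
    unfolding sym_caratheodory_sym_class[OF assms] by (rule arg_cong[of _ _ Sup]) blast
  moreover have "?A k \<subseteq> ball 0 1" for k
    using assms(2)[of k]
    by (auto simp: symmetric_functions_to_disc_def holomorphic_functions_to_disc_def simp del: mem_ball)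
  moreover have "(\<exists>v\<in>?A k. t < norm v) \<longleftrightarrow>
      (\<exists>F\<in>symmetric_functions_to_disc n d X \<A>. F z = 0 \<and> t < norm (F (w k)))" for k t
    by blast
  ultimately show ?thesis
    using SUP_poincare_dist_tendsto_PInfty_iff[of ?A G] by simp
qed

lemma limitin_imp_accumulation_point:
  assumes "limitin Z s a sequentially"
  shows "accumulation_point Z s a"
  unfolding accumulation_point_def
proof (intro conjI allI impI)
  show "a \<in> topspace Z"
    using assms by (rule limitin_topspace)
  fix U assume "openin Z U \<and> a \<in> U"
  then have "\<forall>\<^sub>F k in sequentially. s k \<in> U"
    using assms by (simp add: limitin_def)
  then show "infinite {k. s k \<in> U}"
    by (simp add: INFM_iff_infinite[symmetric] cofinite_eq_sequentially eventually_frequently)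
qed

lemma accumulation_point_subseq:
  assumes "strict_mono (r :: nat \<Rightarrow> nat)" "accumulation_point Z (\<lambda>k. s (r k)) a"
  shows "accumulation_point Z s a"
  unfolding accumulation_point_def
proof (intro conjI allI impI)
  show "a \<in> topspace Z"
    using assms(2) by (simp add: accumulation_point_def)
  fix U assume "openin Z U \<and> a \<in> U"
  then have "infinite {k. s (r k) \<in> U}"
    using assms(2) by (simp add: accumulation_point_def)
  then have "infinite (r ` {k. s (r k) \<in> U})"
    using strict_mono_imp_inj_on[OF assms(1)] by (meson finite_imageD inj_on_subset subset_UNIV)
  moreover have "r ` {k. s (r k) \<in> U} \<subseteq> {k. s k \<in> U}"
    by auto
  ultimately show "infinite {k. s k \<in> U}"
    using infinite_super by blast
qed

text \<open>The definition measures from the first term of the sequence. Prepending \<open>a\<close>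
  makes any point the base point; this will be applied to every coordinate of a base tuple.\<close>

lemma quasi_finitely_compact_tendsto:
  assumes "quasi_finitely_compact Z c" "a \<in> topspace Z" "range s \<subseteq> topspace Z"
    and "\<nexists>b. accumulation_point Z s b"
  shows "(\<lambda>k. c a (s k)) \<longlonglongrightarrow> \<infinity>"
proof -
  let ?s = "case_nat a s"
  have "accumulation_point Z s b" if "accumulation_point Z ?s b" for b
    unfolding accumulation_point_def
  proof (intro conjI allI impI)
    show "b \<in> topspace Z"
      using that by (simp add: accumulation_point_def)
    fix U assume "openin Z U \<and> b \<in> U"
    then have "infinite {k. ?s k \<in> U}"
      using that by (simp add: accumulation_point_def)
    \<comment> \<open>Prepending shifts the indices by one and adds at most the index 0, so
      infinitely many visits remain.\<close>
    moreover have "{k. ?s k \<in> U} \<subseteq> insert 0 (Suc ` {k. s k \<in> U})"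
    proof
      fix k assume "k \<in> {k. ?s k \<in> U}"
      then show "k \<in> insert 0 (Suc ` {k. s k \<in> U})"
        by (cases k) auto
    qed
    ultimately show "infinite {k. s k \<in> U}"
      using finite_subset by blast
  qed
  moreover have "range ?s \<subseteq> topspace Z"
    using assms(2,3) by (auto simp: image_subset_iff split: nat.splits)
  ultimately have "(\<lambda>k. c (?s 0) (?s k)) \<longlonglongrightarrow> \<infinity>"
    using assms(1,4) unfolding quasi_finitely_compact_def by blast
  then show ?thesis
    by (auto dest: LIMSEQ_Suc)
qed

section \<open>Extraction of convergent subsequences\<close>

lemma metrizable_space_chart:
  assumes "is_chart d X (U, \<phi>)"
  shows "metrizable_space (subtopology X U)"
proof -
  have "metrizable_space (cspace d)"
    by (simp add: cspace_def metrizable_space_product_topology metrizable_space_euclidean)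
  then have "metrizable_space (subtopology (cspace d) (\<phi> ` U))"
    by (rule metrizable_space_subtopology)
  moreover have "subtopology X U homeomorphic_space subtopology (cspace d) (\<phi> ` U)"
    using assms by (auto simp: is_chart_def intro: homeomorphic_map_imp_homeomorphic_space)
  ultimately show ?thesis
    by (simp add: homeomorphic_metrizable_space)
qed

text \<open>A chart domain around \<open>a\<close> is metrizable and open in \<open>X\<close>, so
  its metric balls are neighbourhoods of \<open>a\<close> in \<open>X\<close>. Each is visited
  infinitely often, which allows increasing indices to be chosen for shrinking radii.\<close>

lemma accumulation_point_convergent_subseq:
  assumes X: "complex_manifold d X \<A>" and a: "accumulation_point X s a"
  obtains r where "strict_mono (r :: nat \<Rightarrow> nat)" "limitin X (\<lambda>k. s (r k)) a sequentially"
proof -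
  have "a \<in> topspace X"
    using a by (simp add: accumulation_point_def)
  then obtain U \<phi> where U: "(U, \<phi>) \<in> \<A>" "a \<in> U"
    using X unfolding complex_manifold_def by (metis UN_E prod.collapse)
  have chart: "is_chart d X (U, \<phi>)"
    using X U(1) unfolding complex_manifold_def by blast
  then have openU: "openin X U"
    by (simp add: is_chart_def)
  obtain M e where M: "Metric_space M e" and top: "subtopology X U = Metric_space.mtopology M e"
    using metrizable_space_chart[OF chart] by (auto simp: metrizable_space_def)
  interpret Metric_space M e
    by (rule M)
  have "M = U"
    using top openin_subset[OF openU] topspace_mtopology by (metis inf.absorb2 topspace_subtopology)
  have ball_infinite: "infinite {k. s k \<in> mball a \<epsilon>}" if "\<epsilon> > 0" for \<epsilon>
  proof -
    have "openin X (mball a \<epsilon>)"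
      using openin_mball[of a \<epsilon>] openin_trans_full openU unfolding top[symmetric] by blast
    moreover have "a \<in> mball a \<epsilon>"
      using that U(2) \<open>M = U\<close> centre_in_mball_iff[of a \<epsilon>] by blast
    ultimately show ?thesis
      using a by (auto simp: accumulation_point_def)
  qed
  have "\<exists>r. \<forall>m. s (r m) \<in> mball a (inverse (Suc m)) \<and> r m < r (Suc m)"
  proof (rule dependent_nat_choice)
    show "\<exists>k. s k \<in> mball a (inverse (Suc 0))"
      by (rule not_finite_existsD[OF ball_infinite]) simp
    fix k m
    have "infinite {k. s k \<in> mball a (inverse (Suc (Suc m)))}"
      by (rule ball_infinite) simp
    then obtain l where "l > k" "s l \<in> mball a (inverse (Suc (Suc m)))"
      unfolding infinite_nat_iff_unbounded by blast
    then show "\<exists>l. s l \<in> mball a (inverse (Suc (Suc m))) \<and> k < l"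
      by blast
  qed
  then obtain r where r: "\<And>m. s (r m) \<in> mball a (inverse (Suc m))" "\<And>m. r m < r (Suc m)"
    by blast
  have "limitin mtopology (\<lambda>k. s (r k)) a sequentially"
    unfolding limit_metric_sequentially
  proof (intro conjI allI impI)
    show "a \<in> M"
      using U(2) \<open>M = U\<close> by simp
    fix \<epsilon> :: real assume "\<epsilon> > 0"
    then obtain N where N: "inverse (Suc N) < \<epsilon>"
      using reals_Archimedean by blast
    show "\<exists>N. \<forall>k\<ge>N. s (r k) \<in> M \<and> e (s (r k)) a < \<epsilon>"
    proof (intro exI allI impI)
      fix k assume "k \<ge> N"
      then have "inverse (real (Suc k)) \<le> inverse (real (Suc N))"
        by (intro le_imp_inverse_le) auto
      moreover have "s (r k) \<in> M" "e a (s (r k)) < inverse (real (Suc k))"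
        using r(1)[of k] by simp_all
      ultimately show "s (r k) \<in> M \<and> e (s (r k)) a < \<epsilon>"
        using N commute[of a "s (r k)"] by linarith
    qed
  qed
  then have "limitin X (\<lambda>k. s (r k)) a sequentially"
    by (simp add: top[symmetric] limitin_subtopology)
  then show thesis
    using that r(2) strict_mono_Suc_iff by blast
qed

text \<open>The coordinates are treated one after another, each time refining the subsequence found
  so far. Hence accumulation points are assumed along every subsequence.\<close>

lemma simultaneous_convergent_subseq:
  fixes w :: "nat \<Rightarrow> nat \<Rightarrow> 'a"
  assumes X: "complex_manifold d X \<A>"
    and acc: "\<And>i r. i < n \<Longrightarrow> strict_mono (r :: nat \<Rightarrow> nat) \<Longrightarrow> \<exists>a. accumulation_point X (\<lambda>k. w (r k) i) a"
  shows "\<exists>r l. strict_mono (r :: nat \<Rightarrow> nat) \<and> (\<forall>i<n. limitin X (\<lambda>k. w (r k) i) (l i) sequentially)"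
  using acc
proof (induction n)
  case 0
  then show ?case
    using strict_mono_id by auto
next
  case (Suc n)
  then obtain r l where r: "strict_mono (r :: nat \<Rightarrow> nat)"
    and l: "\<forall>i<n. limitin X (\<lambda>k. w (r k) i) (l i) sequentially"
    by (metis less_SucI)
  obtain a where "accumulation_point X (\<lambda>k. w (r k) n) a"
    using Suc.prems[of n r] r by blast
  from accumulation_point_convergent_subseq[OF X this]
  obtain q where q: "strict_mono (q :: nat \<Rightarrow> nat)"
    and a: "limitin X (\<lambda>k. w (r (q k)) n) a sequentially"
    by blast
  have "limitin X (\<lambda>k. w (r (q k)) i) ((l(n := a)) i) sequentially" if "i < Suc n" for i
  proof (cases "i = n")
    case False
    then have "limitin X (\<lambda>k. w (r k) i) (l i) sequentially"
      using that l by simp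
    from limitin_subsequence[OF q this] show ?thesis
      using False by (simp add: o_def)
  qed (use a in simp)
  moreover have "strict_mono (\<lambda>k. r (q k))"
    using strict_mono_o[OF r q] by (simp add: o_def)
  ultimately show ?case
    by (intro exI[of _ "\<lambda>k. r (q k)"] exI[of _ "l(n := a)"]) blast
qed


section \<open>Symmetric functions on powers\<close>

definition power_chart_map :: "nat \<Rightarrow> nat \<Rightarrow> (nat \<Rightarrow> 'a chart) \<Rightarrow> (nat \<Rightarrow> 'a) \<Rightarrow> nat \<Rightarrow> complex" where
  "power_chart_map n d C z = (\<lambda>k\<in>{..<n * d}. snd (C (k div d)) (z (k div d)) (k mod d))"

lemma power_atlas_eq:
  "power_atlas n d \<A> =
     {(\<Pi>\<^sub>E i\<in>{..<n}. fst (C i), power_chart_map n d C) |C. \<forall>i<n. C i \<in> \<A>}"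
  by (simp add: power_atlas_def power_chart_map_def[abs_def])

lemma block_index_less: "i < n \<Longrightarrow> j < d \<Longrightarrow> i * d + j < n * (d::nat)"
  using mult_le_mono1[of "Suc i" n d] by simp

lemma chart_image_extensional:
  assumes "is_chart d X (U, \<phi>)" "x \<in> U"
  shows "\<phi> x \<in> extensional {..<d}"
  using assms openin_subset[of "cspace d" "\<phi> ` U"] by (auto simp: is_chart_def topspace_cspace)

lemma chart_inj_on:
  assumes "is_chart d X (U, \<phi>)"
  shows "inj_on \<phi> U"
proof -
  have "U \<subseteq> topspace X"
    using assms openin_subset by (fastforce simp: is_chart_def)
  then show ?thesis
    using assms homeomorphic_imp_injective_map unfolding is_chart_def
    by (metis (no_types, lifting) case_prod_conv inf.absorb2 topspace_subtopology)
qed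

context
  fixes n d :: nat and X :: "'a topology" and C :: "nat \<Rightarrow> 'a chart"
  assumes charts: "\<And>i. i < n \<Longrightarrow> is_chart d X (C i)"
begin

lemma reindex_power_chart_map:
  assumes "z \<in> (\<Pi>\<^sub>E i\<in>{..<n}. fst (C i))" "i < n"
  shows "reindex d (\<lambda>j. i * d + j) (power_chart_map n d C z) = snd (C i) (z i)"
proof (rule extensionalityI)
  show "snd (C i) (z i) \<in> extensional {..<d}"
    using chart_image_extensional[of d X "fst (C i)" "snd (C i)"] charts[OF assms(2)] assms by auto
qed (use assms(2) in \<open>auto simp: reindex_def power_chart_map_def block_index_less\<close>)

lemma inj_on_power_chart_map: "inj_on (power_chart_map n d C) (\<Pi>\<^sub>E i\<in>{..<n}. fst (C i))"
proof (rule inj_onI)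
  fix z w
  assume zw: "z \<in> (\<Pi>\<^sub>E i\<in>{..<n}. fst (C i))" "w \<in> (\<Pi>\<^sub>E i\<in>{..<n}. fst (C i))"
    and eq: "power_chart_map n d C z = power_chart_map n d C w"
  show "z = w"
  proof (rule PiE_ext[OF zw])
    fix i assume "i \<in> {..<n}"
    then have i: "i < n"
      by simp
    have "snd (C i) (z i) = snd (C i) (w i)"
      using reindex_power_chart_map[OF zw(1) i] reindex_power_chart_map[OF zw(2) i] eq by simp
    moreover have "inj_on (snd (C i)) (fst (C i))"
      using chart_inj_on charts[OF i] by (metis prod.collapse)
    ultimately show "z i = w i"
      using zw i by (auto dest: inj_onD)
  qed
qed

text \<open>The image consists of the points whose \<open>i\<close>-th block lies in the image of
  the \<open>i\<close>-th chart, for every \<open>i\<close>. It is thus a finite intersection of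
  preimages of open sets under continuous block projections.\<close>

lemma openin_power_chart_image:
  "openin (cspace (n * d)) (power_chart_map n d C ` (\<Pi>\<^sub>E i\<in>{..<n}. fst (C i)))"
proof -
  let ?T = "topspace (cspace (n * d))"
  let ?W = "\<lambda>i. {x \<in> ?T. reindex d (\<lambda>j. i * d + j) x \<in> snd (C i) ` fst (C i)}"
  have "openin (cspace (n * d)) (?W i)" if "i < n" for i
  proof (rule openin_continuous_map_preimage)
    show "continuous_map (cspace (n * d)) (cspace d) (reindex d (\<lambda>j. i * d + j))"
      by (intro continuous_map_reindex block_index_less that)
    show "openin (cspace d) (snd (C i) ` fst (C i))"
      using charts[OF that] by (auto simp: is_chart_def split: prod.splits)
  qed
  \<comment> \<open>Intersecting with \<open>?T\<close> gives the right set also for n = 0, where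
    the intersection over the empty index set is everything.\<close>
  then have "openin (cspace (n * d)) ((\<Inter>i\<in>{..<n}. ?W i) \<inter> ?T)"
    by (intro openin_INT) auto
  moreover have "(\<Inter>i\<in>{..<n}. ?W i) \<inter> ?T = power_chart_map n d C ` (\<Pi>\<^sub>E i\<in>{..<n}. fst (C i))"
  proof (intro equalityI subsetI)
    fix x assume x: "x \<in> (\<Inter>i\<in>{..<n}. ?W i) \<inter> ?T"
    have "\<exists>y. y \<in> fst (C i) \<and> snd (C i) y = reindex d (\<lambda>j. i * d + j) x" if "i < n" for i
    proof -
      have "reindex d (\<lambda>j. i * d + j) x \<in> snd (C i) ` fst (C i)"
        using x that by blast
      then show ?thesis
        by (metis imageE)
    qed
    then obtain y where y: "\<And>i. i < n \<Longrightarrow> y i \<in> fst (C i)"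
        "\<And>i. i < n \<Longrightarrow> snd (C i) (y i) = reindex d (\<lambda>j. i * d + j) x"
      by metis
    have "power_chart_map n d C (restrict y {..<n}) = x"
    proof (rule extensionalityI)
      show "x \<in> extensional {..<n * d}"
        using x by (simp add: topspace_cspace)
      fix k assume "k \<in> {..<n * d}"
      \<comment> \<open>Coordinate \<open>k\<close> has position \<open>k mod d\<close> in block
        \<open>k div d\<close>; that \<open>k\<close> lies below \<open>n * d\<close> excludes d =
        0.\<close>
      then have "k < n * d" "k div d < n" "k mod d < d"
        by (auto simp: less_mult_imp_div_less intro!: mod_less_divisor gr0I)
      then show "power_chart_map n d C (restrict y {..<n}) k = x k"
        by (simp add: power_chart_map_def y(2) reindex_def)
    qed (simp add: power_chart_map_def)
    then show "x \<in> power_chart_map n d C ` (\<Pi>\<^sub>E i\<in>{..<n}. fst (C i))"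
      using y(1) by (intro image_eqI[of _ _ "restrict y {..<n}"]) auto
  next
    fix x assume "x \<in> power_chart_map n d C ` (\<Pi>\<^sub>E i\<in>{..<n}. fst (C i))"
    then obtain z where z: "z \<in> (\<Pi>\<^sub>E i\<in>{..<n}. fst (C i))" "x = power_chart_map n d C z"
      by blast
    have "x \<in> ?T"
      by (simp add: z(2) topspace_cspace power_chart_map_def)
    moreover have "reindex d (\<lambda>j. i * d + j) x \<in> snd (C i) ` fst (C i)" if "i < n" for i
      unfolding z(2) reindex_power_chart_map[OF z(1) that] using z(1) that by auto
    ultimately show "x \<in> (\<Inter>i\<in>{..<n}. ?W i) \<inter> ?T"
      by blast
  qed
  ultimately show ?thesis
    by simp
qed

end

section \<open>Cayley transform and averaging\<close>

text \<open>The conformal map of the disc onto the right half-plane that takes 0 to 1.\<close>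

definition cayley :: "complex \<Rightarrow> complex" where
  "cayley w = (1 + w) / (1 - w)"

definition cayley_inv :: "complex \<Rightarrow> complex" where
  "cayley_inv s = (s - 1) / (s + 1)"

text \<open>The real part equals (1 - |w|^2) / |1 - w|^2.\<close>

lemma Re_cayley_pos:
  assumes "norm w < 1"
  shows "Re (cayley w) > 0"
proof -
  have "(Re w)\<^sup>2 + (Im w)\<^sup>2 < 1"
    using assms by (simp add: cmod_def)
  moreover have "Re (1 + w) * Re (1 - w) + Im (1 + w) * Im (1 - w) = 1 - ((Re w)\<^sup>2 + (Im w)\<^sup>2)"
    by (simp add: power2_eq_square algebra_simps)
  moreover have "0 < (Re (1 - w))\<^sup>2 + (Im (1 - w))\<^sup>2"
    using assms complex_Re_le_cmod[of w] by (intro add_pos_nonneg) auto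
  ultimately show ?thesis
    unfolding cayley_def Re_divide by simp
qed

text \<open>The difference |s + 1|^2 - |s - 1|^2 equals 4 Re s.\<close>

lemma norm_cayley_inv_less_1:
  assumes "Re s > 0"
  shows "norm (cayley_inv s) < 1"
proof -
  have "(norm (s - 1))\<^sup>2 < (norm (s + 1))\<^sup>2"
    using assms unfolding cmod_power2 by (simp add: power2_eq_square algebra_simps)
  then have "norm (s - 1) < norm (s + 1)"
    by (rule power2_less_imp_less) simp
  then show ?thesis
    by (simp add: cayley_inv_def norm_divide divide_less_eq_1)
qed

text \<open>A large real part forces a modulus close to 1. The bound increases with
  \<open>R\<close>, so \<open>R\<close> may be replaced by |s|; then the triangle inequality applies
  if |s| is at least 1, and otherwise the bound is negative.\<close>

lemma norm_cayley_inv_ge: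
  assumes "0 < R" "R \<le> Re s"
  shows "(R - 1) / (R + 1) \<le> norm (cayley_inv s)"
proof -
  let ?N = "norm s"
  have N: "R \<le> ?N"
    using assms complex_Re_le_cmod[of s] by linarith
  have "s + 1 \<noteq> 0"
    using assms by (auto simp: complex_eq_iff)
  have "(R - 1) / (R + 1) \<le> (?N - 1) / (?N + 1)"
    using assms N by (simp add: field_simps)
  also have "\<dots> \<le> norm (s - 1) / norm (s + 1)"
  proof (cases "?N \<ge> 1")
    case True
    have "?N - 1 \<le> norm (s - 1)" "norm (s + 1) \<le> ?N + 1"
      using norm_triangle_ineq2[of s 1] norm_triangle_ineq[of s 1] by simp_all
    then show ?thesis
      using True \<open>s + 1 \<noteq> 0\<close> by (intro frac_le) auto
  next
    case False
    have "(?N - 1) / (?N + 1) \<le> 0"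
      using False by (intro divide_nonpos_nonneg) auto
    also have "0 \<le> norm (s - 1) / norm (s + 1)"
      by simp
    finally show ?thesis .
  qed
  finally show ?thesis
    by (simp add: cayley_inv_def norm_divide)
qed

text \<open>
  Averaging in the right half-plane, where all values have positive real part, prevents the
  cancellation which could occur in the disc itself.
\<close>

definition half_plane_average :: "nat \<Rightarrow> ('a \<Rightarrow> complex) \<Rightarrow> (nat \<Rightarrow> 'a) \<Rightarrow> complex" where
  "half_plane_average n h z = (1 / of_nat n) * (\<Sum>i<n. cayley (h (z i)))"

lemma Re_half_plane_average:
  "Re (half_plane_average n h z) = (\<Sum>i<n. Re (cayley (h (z i)))) / real n"
  using Re_complex_of_real[of "1 / real n"]
  by (simp add: half_plane_average_def Re_divide_of_nat)

lemma half_plane_average_symmetric: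
  assumes "\<sigma> permutes {..<n}"
  shows "half_plane_average n h (z \<circ> \<sigma>) = half_plane_average n h z"
  using sum.permute[OF assms, of "\<lambda>i. cayley (h (z i))"] by (simp add: half_plane_average_def o_def)

lemma Re_half_plane_average_pos:
  assumes "n \<ge> 1" "\<And>i. i < n \<Longrightarrow> norm (h (z i)) < 1"
  shows "Re (half_plane_average n h z) > 0"
proof -
  have "0 \<in> {..<n}"
    using assms(1) by simp
  then show ?thesis
    unfolding Re_half_plane_average using assms
    by (intro divide_pos_pos sum_pos) (auto simp: Re_cayley_pos simp del: lessThan_iff)
qed

lemma topspace_power_space: "topspace (power_space n X) = (\<Pi>\<^sub>E i\<in>{..<n}. topspace X)"
  by (simp add: power_space_def)

text \<open>In a product chart each summand is \<open>h\<close> in the \<open>i\<close>-th chart,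
  precomposed with a block projection. The poles are avoided: \<open>h\<close> never takes the value
  1, and the average has positive real part, so it never equals -1.\<close>

lemma cayley_inv_half_plane_average_in_symmetric_functions:
  assumes X: "complex_manifold d X \<A>" and n: "n \<ge> 1"
    and h: "h \<in> holomorphic_functions_to_disc d X \<A>"
  shows "(\<lambda>z. cayley_inv (half_plane_average n h z)) \<in> symmetric_functions_to_disc n d X \<A>"
    (is "?F \<in> _")
proof -
  have h_disc: "norm (h x) < 1" if "x \<in> topspace X" for x
    using h that by (auto simp: holomorphic_functions_to_disc_def)
  have disc: "?F ` topspace (power_space n X) \<subseteq> ball 0 1"
  proof (rule image_subsetI)
    fix z assume "z \<in> topspace (power_space n X)"
    then have "norm (h (z i)) < 1" if "i < n" for i
      using that by (intro h_disc) (auto simp: topspace_power_space)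
    then show "?F z \<in> ball 0 1"
      by (simp add: Re_half_plane_average_pos[OF n] norm_cayley_inv_less_1)
  qed
  have hol: "cholomorphic_on (n * d) (\<lambda>x. ?F (inv_into (\<Pi>\<^sub>E i\<in>{..<n}. fst (C i)) (power_chart_map n d C) x))
      (power_chart_map n d C ` (\<Pi>\<^sub>E i\<in>{..<n}. fst (C i)))"
    if C: "\<And>i. i < n \<Longrightarrow> C i \<in> \<A>" for C
  proof -
    let ?U = "\<Pi>\<^sub>E i\<in>{..<n}. fst (C i)"
    let ?\<Phi> = "power_chart_map n d C"
    \<comment> \<open>\<open>?g i\<close> is the function \<open>h (z i)\<close> written in the
      coordinates of the product chart.\<close>
    let ?g = "\<lambda>i x. h (inv_into (fst (C i)) (snd (C i)) (reindex d (\<lambda>j. i * d + j) x))"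
    have charts: "is_chart d X (C i)" if "i < n" for i
      using X C[OF that] by (auto simp: complex_manifold_def)
    have in_X: "fst (C i) \<subseteq> topspace X" if "i < n" for i
      using charts[OF that] openin_subset by (fastforce simp: is_chart_def split: prod.splits)
    have g: "?g i (?\<Phi> z) = h (z i)" if "z \<in> ?U" "i < n" for z i
    proof -
      have inj: "inj_on (snd (C i)) (fst (C i))"
        using chart_inj_on charts[OF that(2)] by (metis prod.collapse)
      have z: "z i \<in> fst (C i)"
        using that by auto
      have "reindex d (\<lambda>j. i * d + j) (?\<Phi> z) = snd (C i) (z i)"
        by (rule reindex_power_chart_map[OF charts that])
      then show ?thesis
        using inv_into_f_f[OF inj z] by simp
    qed
    have g_disc: "norm (?g i x) < 1" if "x \<in> ?\<Phi> ` ?U" "i < n" for x i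
    proof -
      obtain z where z: "z \<in> ?U" "x = ?\<Phi> z"
        using \<open>x \<in> ?\<Phi> ` ?U\<close> by blast
      have "z i \<in> topspace X"
        using z(1) in_X[OF that(2)] that(2) by auto
      then show ?thesis
        unfolding z(2) g[OF z(1) that(2)] by (rule h_disc)
    qed
    have "cholomorphic_on (n * d) (?g i) (?\<Phi> ` ?U)" if i: "i < n" for i
    proof (rule cholomorphic_on_reindex)
      show "cholomorphic_on d (\<lambda>x. h (inv_into (fst (C i)) (snd (C i)) x)) (snd (C i) ` fst (C i))"
        using h C[OF i] by (auto simp: holomorphic_functions_to_disc_def)
      show "?\<Phi> ` ?U \<subseteq> topspace (cspace (n * d))"
        by (intro openin_subset openin_power_chart_image[OF charts])
      show "reindex d (\<lambda>j. i * d + j) ` ?\<Phi> ` ?U \<subseteq> snd (C i) ` fst (C i)"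
        using reindex_power_chart_map[OF charts _ i] i by auto
    qed (rule block_index_less[OF i])
    then have "cholomorphic_on (n * d) (\<lambda>x. cayley (?g i x)) (?\<Phi> ` ?U)" if "i < n" for i
    proof (rule cholomorphic_on_compose_field)
      fix x assume "x \<in> ?\<Phi> ` ?U"
      then have "?g i x \<noteq> 1"
        using g_disc that by fastforce
      then show "cayley field_differentiable (at (?g i x))"
        unfolding cayley_def[abs_def] by (intro derivative_intros) auto
    qed (use that in auto)
    then have avg: "cholomorphic_on (n * d) (\<lambda>x. (1 / of_nat n) * (\<Sum>i<n. cayley (?g i x))) (?\<Phi> ` ?U)"
      by (intro cholomorphic_on_cmult cholomorphic_on_sum) auto
    have avg_eq: "(1 / of_nat n) * (\<Sum>i<n. cayley (?g i (?\<Phi> z))) = half_plane_average n h z"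
      if "z \<in> ?U" for z
      using g[OF that] by (simp add: half_plane_average_def)
    have avg_pos: "Re (half_plane_average n h z) > 0" if "z \<in> ?U" for z
      using that g_disc g by (intro Re_half_plane_average_pos[OF n]) (metis image_eqI)
    have "cholomorphic_on (n * d) (\<lambda>x. cayley_inv ((1 / of_nat n) * (\<Sum>i<n. cayley (?g i x)))) (?\<Phi> ` ?U)"
    proof (rule cholomorphic_on_compose_field[OF avg])
      fix x assume "x \<in> ?\<Phi> ` ?U"
      then obtain z where z: "z \<in> ?U" "x = ?\<Phi> z"
        by blast
      have "half_plane_average n h z + 1 \<noteq> 0"
        using avg_pos[OF z(1)] by (auto simp: complex_eq_iff)
      then show "cayley_inv field_differentiable (at ((1 / of_nat n) * (\<Sum>i<n. cayley (?g i x))))"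
        unfolding z(2) avg_eq[OF z(1)] cayley_inv_def[abs_def] by (intro derivative_intros) auto
    qed
    \<comment> \<open>The formula in coordinates agrees with the pullback of \<open>?F\<close> on
      the chart image, which is open.\<close>
    then show ?thesis
    proof (rule cholomorphic_on_cong[OF openin_power_chart_image[OF charts], rotated 2])
      fix x assume "x \<in> ?\<Phi> ` ?U"
      then obtain z where z: "z \<in> ?U" "x = ?\<Phi> z"
        by blast
      have "inv_into ?U ?\<Phi> (?\<Phi> z) = z"
        using inj_on_power_chart_map[OF charts] z(1) by (rule inv_into_f_f)
      then show "cayley_inv ((1 / of_nat n) * (\<Sum>i<n. cayley (?g i x))) = ?F (inv_into ?U ?\<Phi> x)"
        unfolding z(2) avg_eq[OF z(1)] by simp
    qed auto
  qed
  show ?thesis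
    unfolding symmetric_functions_to_disc_def holomorphic_functions_to_disc_def power_atlas_eq
    using disc hol by (auto simp: half_plane_average_symmetric simp del: mem_ball)
qed


section \<open>Symmetric powers\<close>

lemma sym_class_in_sym_power:
  assumes "z \<in> topspace (power_space n X)"
  shows "sym_class n X z \<in> topspace (sym_power n X)"
  using quotient_imp_surjective_map[OF quotient_map_sym_class] assms by blast

lemma sym_power_representative:
  assumes "P \<in> topspace (sym_power n X)"
  obtains z where "z \<in> topspace (power_space n X)" "P = sym_class n X z"
  using quotient_imp_surjective_map[OF quotient_map_sym_class] assms by blast

section \<open>Restriction to the diagonal\<close>

lemma diagonal_in_holomorphic_functions:
  assumes X: "complex_manifold d X \<A>" and F: "F \<in> symmetric_functions_to_disc n d X \<A>"
  shows "(\<lambda>x. F (\<lambda>i\<in>{..<n}. x)) \<in> holomorphic_functions_to_disc d X \<A>"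
proof -
  have F_hol: "F \<in> holomorphic_functions_to_disc (n * d) (power_space n X) (power_atlas n d \<A>)"
    using F by (simp add: symmetric_functions_to_disc_def)
  have hol: "cholomorphic_on d (\<lambda>x. F (\<lambda>i\<in>{..<n}. inv_into U \<phi> x)) (\<phi> ` U)"
    if U: "(U, \<phi>) \<in> \<A>" for U \<phi>
  proof -
    let ?C = "\<lambda>_::nat. (U, \<phi>)"
    let ?U = "\<Pi>\<^sub>E i\<in>{..<n}. fst (?C i)"
    let ?\<Phi> = "power_chart_map n d ?C"
    \<comment> \<open>In coordinates the diagonal repeats the block \<open>n\<close> times when all
      factors use the same chart.\<close>
    let ?\<delta> = "reindex (n * d) (\<lambda>k. k mod d)"
    have chart: "is_chart d X (U, \<phi>)"
      using X U by (auto simp: complex_manifold_def)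
    then have opn: "openin (cspace d) (\<phi> ` U)"
      by (simp add: is_chart_def)
    have "(?U, ?\<Phi>) \<in> power_atlas n d \<A>"
      unfolding power_atlas_eq mem_Collect_eq by (intro exI[of _ ?C]) (simp add: U)
    then have "cholomorphic_on (n * d) (\<lambda>x. F (inv_into ?U ?\<Phi> x)) (?\<Phi> ` ?U)"
      using F_hol by (auto simp: holomorphic_functions_to_disc_def)
    moreover have const: "(\<lambda>i\<in>{..<n}. x) \<in> ?U" if "x \<in> U" for x
      using that by simp
    moreover have \<delta>: "?\<delta> (\<phi> x) = ?\<Phi> (\<lambda>i\<in>{..<n}. x)" for x
      by (auto simp: fun_eq_iff reindex_def power_chart_map_def less_mult_imp_div_less)
    moreover have "k mod d < d" if "k < n * d" for k
      using that by (intro mod_less_divisor gr0I) auto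
    ultimately have "cholomorphic_on d (\<lambda>x. F (inv_into ?U ?\<Phi> (?\<delta> x))) (\<phi> ` U)"
      using openin_subset[OF opn] by (intro cholomorphic_on_reindex) auto
    then show ?thesis
    proof (rule cholomorphic_on_cong[OF opn, rotated])
      fix y assume "y \<in> \<phi> ` U"
      then obtain x where x: "x \<in> U" "y = \<phi> x"
        by blast
      have "inv_into ?U ?\<Phi> (?\<Phi> (\<lambda>i\<in>{..<n}. x)) = (\<lambda>i\<in>{..<n}. x)"
        using inj_on_power_chart_map[OF chart] const[OF x(1)] by (rule inv_into_f_f)
      moreover have "inv_into U \<phi> (\<phi> x) = x"
        using chart_inj_on[OF chart] x(1) by (rule inv_into_f_f)
      ultimately show "F (inv_into ?U ?\<Phi> (?\<delta> y)) = F (\<lambda>i\<in>{..<n}. inv_into U \<phi> y)"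
        unfolding x(2) \<delta> by simp
    qed
  qed
  moreover have "F (\<lambda>i\<in>{..<n}. x) \<in> ball 0 1" if "x \<in> topspace X" for x
  proof -
    have "(\<lambda>i\<in>{..<n}. x) \<in> topspace (power_space n X)"
      using that by (simp add: topspace_power_space)
    then show ?thesis
      using F_hol unfolding holomorphic_functions_to_disc_def by blast
  qed
  ultimately show ?thesis
    unfolding holomorphic_functions_to_disc_def by blast
qed

lemma sym_class_subset_PiE:
  assumes "z \<in> (\<Pi>\<^sub>E i\<in>{..<n}. V)"
  shows "sym_class n X z \<subseteq> (\<Pi>\<^sub>E i\<in>{..<n}. V)"
proof
  fix w assume "w \<in> sym_class n X z"
  then obtain \<sigma> where \<sigma>: "\<sigma> permutes {..<n}" "w = z \<circ> \<sigma>"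
    by (auto simp: sym_class_def perm_rel_def)
  \<comment> \<open>Regarding \<open>V\<close> as a discrete space makes its cube a power space,
    whose invariance under permutations is known.\<close>
  have "z \<in> topspace (power_space n (discrete_topology V))"
    using assms by (simp add: topspace_power_space)
  then have "w \<in> topspace (power_space n (discrete_topology V))"
    unfolding \<sigma>(2) using \<sigma>(1) by (rule comp_permutes_in_power_space)
  then show "w \<in> (\<Pi>\<^sub>E i\<in>{..<n}. V)"
    by (simp add: topspace_power_space)
qed

text \<open>Around every coordinate of a supposed accumulation point there is an open set which
  \<open>s\<close> visits only finitely often. The cube over the union of these sets yields a
  neighbourhood of the class that contains only finitely many of the diagonal classes.\<close>

lemma no_accumulation_point_diagonal:
  assumes "\<nexists>a. accumulation_point X s a" "range s \<subseteq> topspace X" "n \<ge> 1"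
  shows "\<nexists>P. accumulation_point (sym_power n X) (\<lambda>k. sym_class n X (\<lambda>i\<in>{..<n}. s k)) P"
proof
  assume "\<exists>P. accumulation_point (sym_power n X) (\<lambda>k. sym_class n X (\<lambda>i\<in>{..<n}. s k)) P"
  then obtain P where P: "accumulation_point (sym_power n X) (\<lambda>k. sym_class n X (\<lambda>i\<in>{..<n}. s k)) P"
    by blast
  then obtain a where a: "a \<in> topspace (power_space n X)" "P = sym_class n X a"
    using sym_power_representative by (metis accumulation_point_def)
  have "\<exists>U. openin X U \<and> a i \<in> U \<and> finite {k. s k \<in> U}" if "i < n" for i
  proof -
    have "a i \<in> topspace X"
      using a(1) that by (auto simp: topspace_power_space)
    then show ?thesis
      using assms(1) unfolding accumulation_point_def by blast
  qed
  then obtain U where U: "\<And>i. i < n \<Longrightarrow> openin X (U i)" "\<And>i. i < n \<Longrightarrow> a i \<in> U i"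
      "\<And>i. i < n \<Longrightarrow> finite {k. s k \<in> U i}"
    by metis
  \<comment> \<open>The product of the \<open>U i\<close> need not be invariant under permutations;
    the cube over their union is.\<close>
  define V where "V = (\<Union>i<n. U i)"
  have openV: "openin X V"
    unfolding V_def using U(1) by auto
  let ?W = "{Q \<in> topspace (sym_power n X). Q \<subseteq> (\<Pi>\<^sub>E i\<in>{..<n}. V)}"
  have "\<Union>?W = (\<Pi>\<^sub>E i\<in>{..<n}. V)"
  proof (intro equalityI subsetI)
    fix z assume z: "z \<in> (\<Pi>\<^sub>E i\<in>{..<n}. V)"
    have zX: "z \<in> topspace (power_space n X)"
      using z openin_subset[OF openV] by (auto simp: topspace_power_space)
    have "sym_class n X z \<subseteq> (\<Pi>\<^sub>E i\<in>{..<n}. V)"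
      using z by (rule sym_class_subset_PiE)
    moreover have "z \<in> sym_class n X z"
      unfolding sym_class_def by (rule equiv_class_self[OF equiv_perm_rel zX])
    ultimately show "z \<in> \<Union>?W"
      using sym_class_in_sym_power[OF zX] by blast
  qed blast
  moreover have "openin (power_space n X) (\<Pi>\<^sub>E i\<in>{..<n}. V)"
    unfolding power_space_def by (simp add: openin_PiE openV)
  ultimately have openW: "openin (sym_power n X) ?W"
    using openin_topspace[of "sym_power n X"] unfolding openin_sym_power by auto
  have "a \<in> (\<Pi>\<^sub>E i\<in>{..<n}. V)"
    using a(1) U(2) by (auto simp: topspace_power_space V_def)
  then have "P \<subseteq> (\<Pi>\<^sub>E i\<in>{..<n}. V)"
    unfolding a(2) by (rule sym_class_subset_PiE)
  then have "P \<in> ?W"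
    using P by (simp add: accumulation_point_def)
  then have "infinite {k. sym_class n X (\<lambda>i\<in>{..<n}. s k) \<in> ?W}"
    using P openW unfolding accumulation_point_def by blast
  moreover have "{k. sym_class n X (\<lambda>i\<in>{..<n}. s k) \<in> ?W}
      \<subseteq> (\<Union>i<n. {k. s k \<in> U i})"
  proof
    fix k assume "k \<in> {k. sym_class n X (\<lambda>i\<in>{..<n}. s k) \<in> ?W}"
    then have sub: "sym_class n X (\<lambda>i\<in>{..<n}. s k) \<subseteq> (\<Pi>\<^sub>E i\<in>{..<n}. V)"
      by blast
    have "(\<lambda>i\<in>{..<n}. s k) \<in> topspace (power_space n X)"
      using assms(2) by (auto simp: topspace_power_space)
    then have "(\<lambda>i\<in>{..<n}. s k) \<in> sym_class n X (\<lambda>i\<in>{..<n}. s k)"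
      unfolding sym_class_def by (rule equiv_class_self[OF equiv_perm_rel])
    then have "(\<lambda>i\<in>{..<n}. s k) \<in> (\<Pi>\<^sub>E i\<in>{..<n}. V)"
      using sub by blast
    \<comment> \<open>Coordinate 0 exists because \<open>n\<close> is at least 1.\<close>
    from PiE_mem[OF this, of 0] have "s k \<in> V"
      using assms(3) by simp
    then show "k \<in> (\<Union>i<n. {k. s k \<in> U i})"
      by (simp add: V_def)
  qed
  moreover have "finite (\<Union>i<n. {k. s k \<in> U i})"
    using U(3) by auto
  ultimately show False
    using finite_subset by blast
qed

lemma quasi_finitely_compact_of_sym_power:
  assumes X: "complex_manifold d X \<A>" and n: "n \<ge> 1"
    and sym: "quasi_finitely_compact (sym_power n X) (sym_caratheodory n d X \<A>)"
  shows "quasi_finitely_compact X (caratheodory d X \<A>)"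
  unfolding quasi_finitely_compact_def
proof (intro allI impI)
  fix s assume s: "range s \<subseteq> topspace X \<and> (\<nexists>a. accumulation_point X s a)"
  let ?D = "\<lambda>x. \<lambda>i\<in>{..<n}. x"
  have D: "?D (s k) \<in> topspace (power_space n X)" for k
    using s by (auto simp: topspace_power_space)
  have sX: "s k \<in> topspace X" for k
    using s by blast
  have "range (\<lambda>k. sym_class n X (?D (s k))) \<subseteq> topspace (sym_power n X)"
    using sym_class_in_sym_power[OF D] by blast
  moreover have "\<nexists>P. accumulation_point (sym_power n X) (\<lambda>k. sym_class n X (?D (s k))) P"
    using s n by (intro no_accumulation_point_diagonal) auto
  ultimately have "(\<lambda>k. sym_caratheodory n d X \<A> (sym_class n X (?D (s 0))) (sym_class n X (?D (s k)))) \<longlonglongrightarrow> \<infinity>"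
    using sym unfolding quasi_finitely_compact_def by blast
  then have lim: "\<forall>t<1. \<forall>\<^sub>F k in sequentially.
      \<exists>F\<in>symmetric_functions_to_disc n d X \<A>. F (?D (s 0)) = 0 \<and> t < norm (F (?D (s k)))"
    unfolding sym_caratheodory_tendsto_PInfty_iff[OF D D] .
  show "(\<lambda>k. caratheodory d X \<A> (s 0) (s k)) \<longlonglongrightarrow> \<infinity>"
    unfolding caratheodory_tendsto_PInfty_iff[OF sX]
  proof (intro allI impI)
    fix t :: real assume "t < 1"
    with lim have "\<forall>\<^sub>F k in sequentially.
        \<exists>F\<in>symmetric_functions_to_disc n d X \<A>. F (?D (s 0)) = 0 \<and> t < norm (F (?D (s k)))"
      by blast
    then show "\<forall>\<^sub>F k in sequentially.
        \<exists>f\<in>holomorphic_functions_to_disc d X \<A>. f (s 0) = 0 \<and> t < norm (f (s k))"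
    proof (rule eventually_mono)
      fix k assume "\<exists>F\<in>symmetric_functions_to_disc n d X \<A>. F (?D (s 0)) = 0 \<and> t < norm (F (?D (s k)))"
      then obtain F where F: "F \<in> symmetric_functions_to_disc n d X \<A>" "F (?D (s 0)) = 0"
          "t < norm (F (?D (s k)))"
        by blast
      show "\<exists>f\<in>holomorphic_functions_to_disc d X \<A>. f (s 0) = 0 \<and> t < norm (f (s k))"
        using F(2,3) by (intro bexI[OF _ diagonal_in_holomorphic_functions[OF X F(1)]] conjI)
    qed
  qed
qed

section \<open>Escape in one coordinate forces escape in the symmetric power\<close>

text \<open>
  Rotating and shrinking the product of the functions makes its value at \<open>w\<close> equal to the given
  \<open>\<tau>\<close>, hence real and positive.
\<close>

lemma common_zero_function:
  assumes n: "n \<ge> 1" and w: "w \<in> topspace X" and \<tau>: "0 < \<tau>" "\<tau> < 1"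
    and f: "\<And>j. j < n \<Longrightarrow> \<exists>f\<in>holomorphic_functions_to_disc d X \<A>. f (a j) = 0 \<and> \<tau> < norm (f w)"
  shows "\<exists>h\<in>holomorphic_functions_to_disc d X \<A>. (\<forall>j<n. h (a j) = 0) \<and> h w = of_real (\<tau> ^ n)"
proof -
  have "\<forall>j. \<exists>g. j < n \<longrightarrow> g \<in> holomorphic_functions_to_disc d X \<A> \<and> g (a j) = 0 \<and> \<tau> < norm (g w)"
    using f by blast
  from choice[OF this] obtain f where f: "\<And>j. j < n \<Longrightarrow> f j \<in> holomorphic_functions_to_disc d X \<A>"
      "\<And>j. j < n \<Longrightarrow> f j (a j) = 0" "\<And>j. j < n \<Longrightarrow> \<tau> < norm (f j w)"
    by blast
  define p where "p x = (\<Prod>j<n. f j x)" for x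
  define u where "u = of_real (\<tau> ^ n) / p w"
  define h where "h x = u * p x" for x
  have "\<tau> ^ n = (\<Prod>j<n. \<tau>)"
    by simp
  also have "\<dots> \<le> norm (p w)"
    unfolding p_def prod_norm[symmetric]
    using \<tau> f(3) by (intro prod_mono) (auto intro: less_imp_le)
  finally have pw: "\<tau> ^ n \<le> norm (p w)" .
  have "p w \<noteq> 0"
    using pw zero_less_power[OF \<tau>(1), of n] by auto
  then have hw: "h w = of_real (\<tau> ^ n)"
    by (simp add: h_def u_def)
  have u: "norm u \<le> 1"
    using pw \<open>p w \<noteq> 0\<close> \<tau>(1) by (simp add: u_def norm_divide norm_power)
  have "norm (p x) < 1" if x: "x \<in> topspace X" for x
  proof -
    have lt: "norm (f j x) < 1" if "j < n" for j
      using f(1)[OF that] x by (auto simp: holomorphic_functions_to_disc_def)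
    have "norm (p x) = (\<Prod>j<n. norm (f j x))"
      by (simp add: p_def prod_norm)
    also have "\<dots> < (\<Prod>j<n. 1)"
      using n lt by (intro prod_mono_strict[of 0]) (auto intro: less_imp_le)
    finally show ?thesis
      by simp
  qed
  then have "norm (h x) < 1" if "x \<in> topspace X" for x
    using that u mult_left_le_one_le[of "norm (p x)" "norm u"] by (fastforce simp: h_def norm_mult)
  moreover have "cholomorphic_on d (\<lambda>x. h (inv_into U \<phi> x)) (\<phi> ` U)" if "(U, \<phi>) \<in> \<A>" for U \<phi>
    unfolding h_def p_def using f(1) that
    by (intro cholomorphic_on_cmult cholomorphic_on_prod) (auto simp: holomorphic_functions_to_disc_def)
  ultimately have "h \<in> holomorphic_functions_to_disc d X \<A>"
    by (auto simp: holomorphic_functions_to_disc_def)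
  moreover have "h (a j) = 0" if "j < n" for j
    using f(2) that by (auto simp: h_def p_def)
  ultimately show ?thesis
    using hw by blast
qed

text \<open>Coordinate \<open>i\<close> contributes (1 + s) / (1 - s) to the sum and the others
  contribute positive real parts, so the average has real part at least \<open>R\<close>. The bound
  is (R - 1) / (R + 1), cleared of the denominator 1 - s so that it is continuous at s = 1. At
  \<open>a\<close> the average is 1, which returns to 0.\<close>

lemma symmetric_function_large:
  assumes X: "complex_manifold d X \<A>" and n: "n \<ge> 1"
    and h: "h \<in> holomorphic_functions_to_disc d X \<A>" "\<And>j. j < n \<Longrightarrow> h (a j) = 0"
    and z: "z \<in> topspace (power_space n X)" "i < n" "h (z i) = of_real s" "0 \<le> s" "s < 1"
  shows "\<exists>F\<in>symmetric_functions_to_disc n d X \<A>. F a = 0 \<and>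
    ((1 + s) - real n * (1 - s)) / ((1 + s) + real n * (1 - s)) \<le> norm (F z)"
proof (intro bexI conjI)
  let ?F = "\<lambda>z. cayley_inv (half_plane_average n h z)"
  show "?F \<in> symmetric_functions_to_disc n d X \<A>"
    by (rule cayley_inv_half_plane_average_in_symmetric_functions[OF X n h(1)])
  show "?F a = 0"
    using n h(2) by (simp add: half_plane_average_def cayley_def cayley_inv_def)
  have pos: "Re (cayley (h (z j))) > 0" if "j < n" for j
  proof (rule Re_cayley_pos)
    have "z j \<in> topspace X"
      using z(1) that by (auto simp: topspace_power_space)
    then show "norm (h (z j)) < 1"
      using h(1) by (auto simp: holomorphic_functions_to_disc_def)
  qed
  define R where "R = (1 + s) / (1 - s) / real n"
  have "cayley (h (z i)) = of_real ((1 + s) / (1 - s))"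
    by (simp add: z(3) cayley_def)
  then have "(1 + s) / (1 - s) = Re (cayley (h (z i)))"
    by (simp only: Re_complex_of_real)
  also have "\<dots> \<le> (\<Sum>j<n. Re (cayley (h (z j))))"
    using z(2) pos by (intro member_le_sum) (auto intro: less_imp_le)
  finally have "R \<le> Re (half_plane_average n h z)"
    unfolding R_def Re_half_plane_average by (rule divide_right_mono) simp
  moreover have "R > 0"
    using n z by (simp add: R_def)
  moreover have "((1 + s) - real n * (1 - s)) / ((1 + s) + real n * (1 - s)) = (R - 1) / (R + 1)"
  proof -
    have "real n * (1 - s) > 0"
      using n z(5) by simp
    moreover have "R = (1 + s) / (real n * (1 - s))"
      by (simp add: R_def mult.commute)
    ultimately show ?thesis
      by (simp only: divide_add_eq_iff divide_diff_eq_iff) 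
        (auto simp: divide_simps)
  qed
  ultimately show "((1 + s) - real n * (1 - s)) / ((1 + s) + real n * (1 - s)) \<le> norm (?F z)"
    using norm_cayley_inv_ge by simp
qed

text \<open>A single escaping coordinate \<open>i\<close> suffices, but it must escape from every
  \<open>a j\<close>, since the function built from it has to vanish at all of them.\<close>

lemma sym_caratheodory_tendsto_PInfty:
  assumes X: "complex_manifold d X \<A>" and n: "n \<ge> 1"
    and a: "a \<in> topspace (power_space n X)" and z: "\<And>k. z k \<in> topspace (power_space n X)"
    and i: "i < n" and lim: "\<And>j. j < n \<Longrightarrow> ((\<lambda>k. caratheodory d X \<A> (a j) (z k i)) \<longlongrightarrow> \<infinity>) G"
  shows "((\<lambda>k. sym_caratheodory n d X \<A> (sym_class n X a) (sym_class n X (z k))) \<longlongrightarrow> \<infinity>) G"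
  unfolding sym_caratheodory_tendsto_PInfty_iff[OF a z]
proof (intro allI impI)
  fix t :: real assume t: "t < 1"
  let ?g = "\<lambda>s. ((1 + s) - real n * (1 - s)) / ((1 + s) + real n * (1 - s))"
  have zX: "z k i \<in> topspace X" for k
    using z[of k] i by (auto simp: topspace_power_space)
  \<comment> \<open>The bound \<open>?g\<close> equals 1 at s = 1, so it exceeds \<open>t\<close>
    for some \<tau> below 1. The power \<tau>^n is the value at \<open>z k i\<close> of the
    normalized product of \<open>n\<close> functions.\<close>
  have "((\<lambda>\<tau>. ?g (\<tau> ^ n)) \<longlongrightarrow> ?g (1 ^ n)) (at_left 1)"
    by (intro tendsto_intros) auto
  then have "\<forall>\<^sub>F \<tau> in at_left 1. t < ?g (\<tau> ^ n)"
    using t by (intro order_tendstoD(1)) auto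
  moreover have "\<forall>\<^sub>F \<tau> in at_left (1::real). \<tau> \<in> {0<..<1}"
    by (rule eventually_at_leftI[of 0]) auto
  ultimately have "\<forall>\<^sub>F \<tau> in at_left 1. t < ?g (\<tau> ^ n) \<and> \<tau> \<in> {0<..<1}"
    by (rule eventually_conj)
  then obtain \<tau> where \<tau>: "t < ?g (\<tau> ^ n)" "0 < \<tau>" "\<tau> < 1"
    using eventually_happens'[OF trivial_limit_at_left_real] by force
  have "\<forall>\<^sub>F k in G. \<exists>f\<in>holomorphic_functions_to_disc d X \<A>. f (a j) = 0 \<and> \<tau> < norm (f (z k i))"
    if "j < n" for j
    using lim[OF that] \<tau>(3) unfolding caratheodory_tendsto_PInfty_iff[where w = "\<lambda>k. z k i", OF zX] by blast
  then have "\<forall>\<^sub>F k in G. \<forall>j\<in>{..<n}.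
      \<exists>f\<in>holomorphic_functions_to_disc d X \<A>. f (a j) = 0 \<and> \<tau> < norm (f (z k i))"
    by (intro eventually_ball_finite) auto
  then show "\<forall>\<^sub>F k in G. \<exists>F\<in>symmetric_functions_to_disc n d X \<A>. F a = 0 \<and> t < norm (F (z k))"
  proof (rule eventually_mono)
    fix k assume "\<forall>j\<in>{..<n}.
      \<exists>f\<in>holomorphic_functions_to_disc d X \<A>. f (a j) = 0 \<and> \<tau> < norm (f (z k i))"
    then obtain h where h: "h \<in> holomorphic_functions_to_disc d X \<A>" "\<And>j. j < n \<Longrightarrow> h (a j) = 0"
        "h (z k i) = of_real (\<tau> ^ n)"
      using common_zero_function[OF n zX \<tau>(2,3), where d = d and \<A> = \<A> and a = a] by (metis lessThan_iff)
    have "\<tau> ^ n < 1"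
      using \<tau> n by (simp add: power_less_one_iff)
    then obtain F where "F \<in> symmetric_functions_to_disc n d X \<A>" "F a = 0" "?g (\<tau> ^ n) \<le> norm (F (z k))"
      using symmetric_function_large[where a = a and h = h, OF X n h(1,2) z i h(3)] \<tau>(2) by auto
    then show "\<exists>F\<in>symmetric_functions_to_disc n d X \<A>. F a = 0 \<and> t < norm (F (z k))"
      using \<tau>(1) by (meson less_le_trans)
  qed
qed

text \<open>If divergence fails, the pseudodistances stay bounded along a subsequence. Boundedness
  keeps every coordinate from escaping, so the coordinates converge along a further subsequence, and
  the class of their limit is a forbidden accumulation point.\<close>

lemma quasi_finitely_compact_sym_power:
  assumes X: "complex_manifold d X \<A>" and n: "n \<ge> 1"
    and qfc: "quasi_finitely_compact X (caratheodory d X \<A>)"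
  shows "quasi_finitely_compact (sym_power n X) (sym_caratheodory n d X \<A>)"
  unfolding quasi_finitely_compact_def
proof (intro allI impI)
  fix s assume s: "range s \<subseteq> topspace (sym_power n X) \<and> (\<nexists>P. accumulation_point (sym_power n X) s P)"
  then have "\<exists>z. z \<in> topspace (power_space n X) \<and> s k = sym_class n X z" for k
    by (metis range_subsetD sym_power_representative)
  then obtain z where z: "\<And>k. z k \<in> topspace (power_space n X)" "\<And>k. s k = sym_class n X (z k)"
    by metis
  show "(\<lambda>k. sym_caratheodory n d X \<A> (s 0) (s k)) \<longlonglongrightarrow> \<infinity>"
  proof (rule ccontr)
    assume "\<not> ?thesis"
    then obtain B where "\<exists>\<^sub>F k in sequentially. \<not> ereal B < sym_caratheodory n d X \<A> (s 0) (s k)"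
      unfolding tendsto_PInfty not_eventually[symmetric] by blast
    then have "infinite {k. \<not> ereal B < sym_caratheodory n d X \<A> (s 0) (s k)}"
      by (simp add: INFM_iff_infinite[symmetric] cofinite_eq_sequentially)
    from infinite_enumerate[OF this]
    obtain q where q: "strict_mono (q :: nat \<Rightarrow> nat)"
      and bound: "\<And>k. \<not> ereal B < sym_caratheodory n d X \<A> (s 0) (s (q k))"
      by auto
    \<comment> \<open>The bound passes to each further subsequence \<open>r\<close>, which is the
      form needed for the simultaneous extraction.\<close>
    have "\<exists>a. accumulation_point X (\<lambda>k. z (q (r k)) i) a" if i: "i < n" and r: "strict_mono r" for i r
    proof (rule ccontr)
      assume no: "\<not> ?thesis"
      have "z (q (r k)) i \<in> topspace X" for k
        using z(1)[of "q (r k)"] i by (auto simp: topspace_power_space)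
      moreover have "z 0 j \<in> topspace X" if "j < n" for j
        using z(1)[of 0] that by (auto simp: topspace_power_space)
      ultimately have "(\<lambda>k. caratheodory d X \<A> (z 0 j) (z (q (r k)) i)) \<longlonglongrightarrow> \<infinity>" if "j < n" for j
        using no that by (intro quasi_finitely_compact_tendsto[OF qfc]) auto
      then have "(\<lambda>k. sym_caratheodory n d X \<A> (sym_class n X (z 0)) (sym_class n X (z (q (r k))))) \<longlonglongrightarrow> \<infinity>"
        using z(1) i by (intro sym_caratheodory_tendsto_PInfty[OF X n, where i = i]) auto
      then have "\<forall>\<^sub>F k in sequentially. ereal B < sym_caratheodory n d X \<A> (s 0) (s (q (r k)))"
        unfolding tendsto_PInfty z(2) by blast
      then show False
        using bound by simp
    qed
    from simultaneous_convergent_subseq[where w = "\<lambda>k. z (q k)", OF X this]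
    obtain r l where r: "strict_mono r"
      and l: "\<And>i. i < n \<Longrightarrow> limitin X (\<lambda>k. z (q (r k)) i) (l i) sequentially"
      by blast
    \<comment> \<open>Restricting \<open>l\<close> makes the limit tuple extensional, hence a point
      of the power space.\<close>
    have "limitin X (\<lambda>k. z (q (r k)) i) (restrict l {..<n} i) sequentially" if "i \<in> {..<n}" for i
      using l that by simp
    then have "limitin (power_space n X) (\<lambda>k. z (q (r k))) (restrict l {..<n}) sequentially"
      unfolding power_space_def limitin_componentwise using z(1) by (auto simp: power_space_def)
    from continuous_map_limit[OF quotient_imp_continuous_map[OF quotient_map_sym_class] this]
    have "limitin (sym_power n X) (\<lambda>k. s (q (r k))) (sym_class n X (restrict l {..<n})) sequentially"
      by (simp add: o_def z(2))
    then have "accumulation_point (sym_power n X) (\<lambda>k. s (q (r k))) (sym_class n X (restrict l {..<n}))"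
      by (rule limitin_imp_accumulation_point)
    moreover have "strict_mono (\<lambda>k. q (r k))"
      using strict_mono_o[OF q r] by (simp add: o_def)
    ultimately have "accumulation_point (sym_power n X) s (sym_class n X (restrict l {..<n}))"
      by (intro accumulation_point_subseq[where s = s and r = "\<lambda>k. q (r k)"])
    then show False
      using s by blast
  qed
qed

theorem theorem1:
  fixes X :: "'a topology" and \<A> :: "'a chart set" and d n :: nat
  assumes "complex_manifold d X \<A>"
    and "connected_space X"
    and "n \<ge> 1"
  shows "quasi_finitely_compact (sym_power n X) (sym_caratheodory n d X \<A>) \<longleftrightarrow>
         quasi_finitely_compact X (caratheodory d X \<A>)"
  using quasi_finitely_compact_of_sym_power[OF assms(1,3)]
    quasi_finitely_compact_sym_power[OF assms(1,3)] by blast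

end
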